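(* Consider any discrete memoryless two-user multiple access channel with generalized feedback (MAC-GF) whose transition probability has the form $$p(y,y_{F_1},y_{F_2}|x_1,x_2)=p(y|x_1,x_2)\,p(y_{F_1}|y)\,p(y_{F_2}|y).$$ Its capacity region is contained in the region $\mathcal{DB}^{MAC}_{NF}$, defined as the set (union over all admissible distributions) of all pairs $(R_1,R_2)$ of nonnegative reals for which there exist random variables $(T,X_1,X_2,Y,Y_{F_1},Y_{F_2})$ with $$R_1\le I(X_1;Y|X_2,T),\qquad R_2\le I(X_2;Y|X_1,T),\qquad R_1+R_2\le I(X_1,X_2;Y|T),$$ whose joint distribution has the form $$p(t,x_1,x_2,y,y_{F_1},y_{F_2})=p(t,x_1,x_2)\,p(y|x_1,x_2)\,p(y_{F_1}|y)\,p(y_{F_2}|y),$$ and which satisfy the dependence balance bound $$I(X_1;X_2|T)\le I(X_1;X_2|Y_{F_1},Y_{F_2},T),$$ where the alphabet $\mathcal T$ of $T$ is subject to the cardinality constraint $|\mathcal T|\le|\mathcal X_1||\mathcal X_2|+3$.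
   Context: A discrete memoryless MAC-GF consists of finite input alphabets $\mathcal X_1,\mathcal X_2$, a finite receiver output alphabet $\mathcal Y$, finite feedback alphabets $\mathcal Y_{F_1},\mathcal Y_{F_2}$ (at transmitters 1 and 2), and a transition probability $p(y,y_{F_1},y_{F_2}|x_1,x_2)$, used memorylessly. An $(n,M_1,M_2,P_e)$ code consists of encoding functions $f_{ki}:\{1,\dots,M_k\}\times\mathcal Y_{F_k}^{i-1}\to\mathcal X_k$, $k=1,2$, $i=1,\dots,n$ (so $X_{ki}=f_{ki}(W_k,Y_{F_k}^{i-1})$), and a decoder $g:\mathcal Y^n\to\{1,\dots,M_1\}\times\{1,\dots,M_2\}$. The messages $W_1,W_2$ are independent and uniform on $\{1,\dots,M_1\}$, $\{1,\dots,M_2\}$, and $P_e=\Pr[(\hat W_1,\hat W_2)\ne(W_1,W_2)]$, where $(\hat W_1,\hat W_2)=g(Y^n)$. A pair $(R_1,R_2)$ of nonnegative reals is achievable if for every $\epsilon>0$ and all sufficiently large $n$ there is a code with $R_1\le \log(M_1)/n$, $R_2\le\log(M_2)/n$ and $P_e\le\epsilon$. The capacity region is the closure of the set of achievable pairs. *)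

theory Defs
  imports "HOL-Probability.Probability"
begin

text \<open>
  Alphabets are finite types, and conditional probabilities are functions into \<open>pmf\<close>.
  A channel \<open>W\<close> maps the inputs \<open>x1 x2\<close> to the joint distribution of
  \<open>(y, yF1, yF2)\<close>. Logarithms are to base 2.
\<close>

type_synonym ('x1, 'x2, 'y, 'f1, 'f2) mac_gf = "'x1 \<Rightarrow> 'x2 \<Rightarrow> ('y \<times> 'f1 \<times> 'f2) pmf"

text \<open>
  An encoder maps a message and the list of past feedback symbols (oldest first) to the next
  input; its restriction to lists of length \<open>i - 1\<close> is the encoding function at time \<open>i\<close>.
\<close>

type_synonym ('f, 'x) encoder = "nat \<Rightarrow> 'f list \<Rightarrow> 'x"

primrec transmission ::
  "('x1, 'x2, 'y, 'f1, 'f2) mac_gf \<Rightarrow> ('f1, 'x1) encoder \<Rightarrow> ('f2, 'x2) encoder \<Rightarrow>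
    nat \<Rightarrow> nat \<Rightarrow> nat \<Rightarrow> ('y \<times> 'f1 \<times> 'f2) list pmf" where
  "transmission W e1 e2 w1 w2 0 = return_pmf []"
| "transmission W e1 e2 w1 w2 (Suc i) =
    bind_pmf (transmission W e1 e2 w1 w2 i) (\<lambda>h.
      map_pmf (\<lambda>z. h @ [z])
        (W (e1 w1 (map (\<lambda>(y, yF1, yF2). yF1) h)) (e2 w2 (map (\<lambda>(y, yF1, yF2). yF2) h))))"

definition messages_and_output ::
  "('x1, 'x2, 'y, 'f1, 'f2) mac_gf \<Rightarrow> nat \<Rightarrow> nat \<Rightarrow> nat \<Rightarrow>
    ('f1, 'x1) encoder \<Rightarrow> ('f2, 'x2) encoder \<Rightarrow> ((nat \<times> nat) \<times> 'y list) pmf" where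
  "messages_and_output W n M1 M2 e1 e2 =
    bind_pmf (pair_pmf (pmf_of_set {1..M1}) (pmf_of_set {1..M2})) (\<lambda>(w1, w2).
      map_pmf (\<lambda>h. ((w1, w2), map fst h)) (transmission W e1 e2 w1 w2 n))"

definition error_prob ::
  "('x1, 'x2, 'y, 'f1, 'f2) mac_gf \<Rightarrow> nat \<Rightarrow> nat \<Rightarrow> nat \<Rightarrow>
    ('f1, 'x1) encoder \<Rightarrow> ('f2, 'x2) encoder \<Rightarrow> ('y list \<Rightarrow> nat \<times> nat) \<Rightarrow> real" where
  "error_prob W n M1 M2 e1 e2 g =
    measure_pmf.prob (messages_and_output W n M1 M2 e1 e2) {(w, ys). g ys \<noteq> w}"

text \<open>Positivity of \<open>M1\<close> and \<open>M2\<close> is needed because \<^term>\<open>pmf_of_set {}\<close> is unspecified.\<close>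

definition is_code ::
  "('x1, 'x2, 'y, 'f1, 'f2) mac_gf \<Rightarrow> nat \<Rightarrow> nat \<Rightarrow> nat \<Rightarrow> real \<Rightarrow>
    ('f1, 'x1) encoder \<Rightarrow> ('f2, 'x2) encoder \<Rightarrow> ('y list \<Rightarrow> nat \<times> nat) \<Rightarrow> bool" where
  "is_code W n M1 M2 Pe e1 e2 g \<longleftrightarrow>
    M1 \<ge> 1 \<and> M2 \<ge> 1 \<and>
    (\<forall>ys. length ys = n \<longrightarrow> g ys \<in> {1..M1} \<times> {1..M2}) \<and>
    Pe = error_prob W n M1 M2 e1 e2 g"

definition achievable ::
  "('x1, 'x2, 'y, 'f1, 'f2) mac_gf \<Rightarrow> real \<times> real \<Rightarrow> bool" where
  "achievable W = (\<lambda>(R1, R2).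
    R1 \<ge> 0 \<and> R2 \<ge> 0 \<and>
    (\<forall>\<epsilon>>0. \<forall>\<^sub>F n in sequentially.
      \<exists>M1 M2 Pe e1 e2 g. is_code W n M1 M2 Pe e1 e2 g \<and>
        R1 \<le> log 2 (real M1) / real n \<and> R2 \<le> log 2 (real M2) / real n \<and> Pe \<le> \<epsilon>))"

definition capacity_region ::
  "('x1, 'x2, 'y, 'f1, 'f2) mac_gf \<Rightarrow> (real \<times> real) set" where
  "capacity_region W = closure {R. achievable W R}"

abbreviation cond_mutual_info ::
  "'w pmf \<Rightarrow> ('w \<Rightarrow> 'a) \<Rightarrow> ('w \<Rightarrow> 'b) \<Rightarrow> ('w \<Rightarrow> 'c) \<Rightarrow> real" where
  "cond_mutual_info p A B C \<equiv>
    prob_space.conditional_mutual_information (measure_pmf p) 2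
      (count_space UNIV) (count_space UNIV) (count_space UNIV) A B C"

text \<open>
  The random variables \<open>(T, X1, X2, Y, YF1, YF2)\<close> are the coordinate projections under their
  joint distribution \<open>p\<close>, which determines all the information quantities. The alphabet
  \<open>\<T>\<close> of \<open>T\<close> is a finite set, taken without loss of generality to consist of natural numbers.
\<close>

definition DB_NF ::
  "('x1::finite \<Rightarrow> 'x2::finite \<Rightarrow> 'y::finite pmf) \<Rightarrow>
    ('y \<Rightarrow> 'f1::finite pmf) \<Rightarrow> ('y \<Rightarrow> 'f2::finite pmf) \<Rightarrow> (real \<times> real) set" where
  "DB_NF P Q1 Q2 = {(R1, R2). R1 \<ge> 0 \<and> R2 \<ge> 0 \<and>
    (\<exists>(\<T> :: nat set) (q :: (nat \<times> 'x1 \<times> 'x2) pmf)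
        (p :: (nat \<times> 'x1 \<times> 'x2 \<times> 'y \<times> 'f1 \<times> 'f2) pmf).
      let T = (\<lambda>(t, x1, x2, y, yF1, yF2). t);
          X1 = (\<lambda>(t, x1, x2, y, yF1, yF2). x1);
          X2 = (\<lambda>(t, x1, x2, y, yF1, yF2). x2);
          Y = (\<lambda>(t, x1, x2, y, yF1, yF2). y);
          YF1 = (\<lambda>(t, x1, x2, y, yF1, yF2). yF1);
          YF2 = (\<lambda>(t, x1, x2, y, yF1, yF2). yF2)
      in
        finite \<T> \<and> card \<T> \<le> CARD('x1) * CARD('x2) + 3 \<and> set_pmf (map_pmf T p) \<subseteq> \<T> \<and>
        (\<forall>t x1 x2 y yF1 yF2.
          pmf p (t, x1, x2, y, yF1, yF2) =
            pmf q (t, x1, x2) * pmf (P x1 x2) y * pmf (Q1 y) yF1 * pmf (Q2 y) yF2) \<and>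
        R1 \<le> cond_mutual_info p X1 Y (\<lambda>\<omega>. (X2 \<omega>, T \<omega>)) \<and>
        R2 \<le> cond_mutual_info p X2 Y (\<lambda>\<omega>. (X1 \<omega>, T \<omega>)) \<and>
        R1 + R2 \<le> cond_mutual_info p (\<lambda>\<omega>. (X1 \<omega>, X2 \<omega>)) Y T \<and>
        cond_mutual_info p X1 X2 T \<le>
          cond_mutual_info p X1 X2 (\<lambda>\<omega>. (YF1 \<omega>, YF2 \<omega>, T \<omega>)))}"

end

theory Submission
  imports Defs
begin

text \<open>
  For a code of length \<open>n\<close> write \<open>Z\<^sub>i = (Y\<^sub>i, F\<^sub>i)\<close> for the outputs at time \<open>i\<close>, where \<open>F\<^sub>i\<close> is the pair of
  feedback symbols, and take \<open>T\<^sub>i\<close> to be all feedback received before time \<open>i\<close>. Each input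
  \<open>X\<^sub>k\<^sub>i\<close> is a function of \<open>(W\<^sub>k, T\<^sub>i)\<close>, and the channel makes \<open>Z\<^sub>i\<close> depend on the past only through the two inputs.
  Hence, as conditioning reduces entropy, the increments of \<open>I(W\<^sub>1; Z\<^sup>n | W\<^sub>2)\<close>, \<open>I(W\<^sub>2; Z\<^sup>n | W\<^sub>1)\<close> and
  \<open>I(W\<^sub>1, W\<^sub>2; Z\<^sup>n)\<close> are bounded by the single-letter informations given \<open>T\<^sub>i\<close>, and Fano's inequality
  bounds the rates. The increments of \<open>I(W\<^sub>1; W\<^sub>2 | F\<^sup>i)\<close> are bounded by
  \<open>I(X\<^sub>1; X\<^sub>2 | F, T) - I(X\<^sub>1; X\<^sub>2 | T)\<close>; their sum is nonnegative because the messages are independent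
  initially, which is the dependence balance bound.

  All four single-letter quantities are averages over \<open>T\<close> of continuous functions of the conditional law of
  \<open>(X\<^sub>1, X\<^sub>2)\<close>. Up to vanishing errors, the time average of a code therefore lies in the convex hull of a
  compact set in a four-dimensional space. This hull is compact, which handles the limit and the closure, and by
  Caratheodory five values of \<open>T\<close> suffice (one value if the input alphabets are trivial), which is
  within the bound \<open>|X\<^sub>1| |X\<^sub>2| + 3\<close>.
\<close>

section \<open>Entropy of finitely supported distributions\<close>

text \<open>The expectation of the self-information under the law itself. In this integral form the
  entropy of a random variable pulls back to the underlying space, so entropies of several variables
  can be combined under one integral.\<close>

definition ent :: "'a pmf \<Rightarrow> real" where
  "ent p = (\<integral>x. - log 2 (pmf p x) \<partial>measure_pmf p)"

abbreviation H :: "'w pmf \<Rightarrow> ('w \<Rightarrow> 'a) \<Rightarrow> real" where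
  "H p X \<equiv> ent (map_pmf X p)"

lemma integral_pmf_cong:
  fixes f g :: "'a \<Rightarrow> real"
  assumes "\<And>x. x \<in> set_pmf p \<Longrightarrow> f x = g x"
  shows "(\<integral>x. f x \<partial>measure_pmf p) = (\<integral>x. g x \<partial>measure_pmf p)"
  by (rule integral_cong_AE) (auto simp: AE_measure_pmf_iff assms)

lemma integral_pmf_sum:
  fixes f :: "'a \<Rightarrow> real"
  assumes "finite (set_pmf p)"
  shows "(\<integral>x. f x \<partial>measure_pmf p) = (\<Sum>x\<in>set_pmf p. pmf p x * f x)"
  using integral_measure_pmf[OF assms, of p f] by simp

lemma H_eq: "H p X = (\<integral>\<omega>. - log 2 (pmf (map_pmf X p) (X \<omega>)) \<partial>measure_pmf p)"
  by (simp add: ent_def)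

lemma ent_map_inj:
  assumes "inj_on X (set_pmf p)"
  shows "H p X = ent p"
  unfolding H_eq ent_def[of p]
  by (rule integral_pmf_cong) (simp add: pmf_map_inj[OF assms])

text \<open>Relabelling values injectively keeps their probabilities. This serves to reorder and
  rebracket tuples of random variables.\<close>

lemma H_inj:
  assumes "inj_on f (X ` set_pmf p)" and "\<And>\<omega>. \<omega> \<in> set_pmf p \<Longrightarrow> X' \<omega> = f (X \<omega>)"
  shows "H p X' = H p X"
proof -
  have "map_pmf X' p = map_pmf f (map_pmf X p)"
    unfolding map_pmf_comp using assms(2) by (intro map_pmf_cong) auto
  then show ?thesis using assms(1) by (simp add: ent_map_inj)
qed

text \<open>Nonnegativity of relative entropy: \<open>ln z \<le> z - 1\<close> at
  \<open>z = r x / pmf p x\<close>, averaged over \<open>p\<close>. As \<open>r\<close> need only be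
  a subprobability on the support of \<open>p\<close>, a comparison law may put mass
  elsewhere.\<close>

lemma gibbs_inequality:
  assumes fin: "finite (set_pmf p)"
    and pos: "\<And>x. x \<in> set_pmf p \<Longrightarrow> r x > 0"
    and le: "(\<Sum>x\<in>set_pmf p. r x) \<le> 1"
  shows "ent p \<le> (\<integral>x. - log 2 (r x) \<partial>measure_pmf p)"
proof -
  have "ent p - (\<integral>x. - log 2 (r x) \<partial>measure_pmf p) = (\<Sum>x\<in>set_pmf p. pmf p x * (log 2 (r x) - log 2 (pmf p x)))"
    unfolding ent_def integral_pmf_sum[OF fin] by (simp add: sum_subtractf[symmetric] algebra_simps)
  also have "\<dots> \<le> (\<Sum>x\<in>set_pmf p. (r x - pmf p x) / ln 2)"
  proof (rule sum_mono)
    fix x assume x: "x \<in> set_pmf p"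
    then have p: "pmf p x > 0" by (simp add: pmf_positive_iff)
    have "ln (r x / pmf p x) \<le> r x / pmf p x - 1"
      using p pos[OF x] by (intro ln_le_minus_one) simp
    then have "pmf p x * ln (r x / pmf p x) \<le> pmf p x * (r x / pmf p x - 1)"
      using p by (intro mult_left_mono) auto
    also have "\<dots> = r x - pmf p x" using p by (simp add: field_simps)
    finally have *: "pmf p x * (ln (r x) - ln (pmf p x)) \<le> r x - pmf p x"
      using p pos[OF x] by (simp add: ln_div)
    have "pmf p x * (log 2 (r x) - log 2 (pmf p x)) = pmf p x * (ln (r x) - ln (pmf p x)) / ln 2"
      by (simp add: log_def diff_divide_distrib right_diff_distrib)
    also have "\<dots> \<le> (r x - pmf p x) / ln 2"
      using * by (intro divide_right_mono) auto
    finally show "pmf p x * (log 2 (r x) - log 2 (pmf p x)) \<le> (r x - pmf p x) / ln 2" .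
  qed
  also have "\<dots> = ((\<Sum>x\<in>set_pmf p. r x) - 1) / ln 2"
    using sum_pmf_eq_1[OF fin order_refl] by (simp add: sum_divide_distrib[symmetric] sum_subtractf)
  also have "\<dots> \<le> 0" using le by (simp add: divide_nonpos_pos)
  finally show ?thesis by simp
qed

section \<open>Joint laws given by a kernel, and the chain rule\<close>

definition joint_pmf :: "'a pmf \<Rightarrow> ('a \<Rightarrow> 'b pmf) \<Rightarrow> ('a \<times> 'b) pmf" where
  "joint_pmf p K = bind_pmf p (\<lambda>x. map_pmf (Pair x) (K x))"

lemma set_joint_pmf: "set_pmf (joint_pmf p K) = Sigma (set_pmf p) (\<lambda>x. set_pmf (K x))"
  by (auto simp: joint_pmf_def)

lemma map_fst_joint_pmf: "map_pmf fst (joint_pmf p K) = p"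
  by (simp add: joint_pmf_def map_bind_pmf map_pmf_comp bind_return_pmf')

lemma pmf_joint_pmf: "pmf (joint_pmf p K) (x, y) = pmf p x * pmf (K x) y"
proof -
  have "pmf (map_pmf (Pair x') (K x')) (x, y) = indicator {x} x' * pmf (K x) y" for x'
  proof (cases "x' = x")
    case True
    then show ?thesis using pmf_map_inj'[of "Pair x" "K x" y] by (simp add: inj_on_def)
  next
    case False
    then show ?thesis by (auto simp: pmf_eq_0_set_pmf)
  qed
  then show ?thesis
    by (simp add: joint_pmf_def pmf_bind measure_pmf_single)
qed

text \<open>Chain rule: the logarithm of \<open>pmf p x * pmf (K x) y\<close> splits, and each
  \<open>K x\<close> has total mass one. The conditional entropy appears as the average entropy of
  the kernel.\<close>

lemma ent_joint_pmf:
  assumes fin: "finite (set_pmf p)" "\<And>x. x \<in> set_pmf p \<Longrightarrow> finite (set_pmf (K x))"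
  shows "ent (joint_pmf p K) = ent p + (\<integral>x. ent (K x) \<partial>measure_pmf p)"
proof -
  have fj: "finite (set_pmf (joint_pmf p K))" using fin by (simp add: set_joint_pmf)
  have "ent (joint_pmf p K) =
     (\<Sum>x\<in>set_pmf p. \<Sum>y\<in>set_pmf (K x). pmf p x * pmf (K x) y * - log 2 (pmf p x * pmf (K x) y))"
    unfolding ent_def integral_pmf_sum[OF fj] unfolding set_joint_pmf
    using fin by (subst sum.Sigma) (auto simp: pmf_joint_pmf intro!: sum.cong)
  also have "\<dots> = (\<Sum>x\<in>set_pmf p. pmf p x * - log 2 (pmf p x) + pmf p x * ent (K x))"
  proof (rule sum.cong[OF refl])
    fix x assume x: "x \<in> set_pmf p"
    then have px: "pmf p x > 0" by (simp add: pmf_positive_iff)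
    have "(\<Sum>y\<in>set_pmf (K x). pmf p x * pmf (K x) y * - log 2 (pmf p x * pmf (K x) y)) =
        (\<Sum>y\<in>set_pmf (K x). pmf (K x) y * (pmf p x * - log 2 (pmf p x)) +
           pmf p x * (pmf (K x) y * - log 2 (pmf (K x) y)))"
      using px by (intro sum.cong) (auto simp: log_mult pmf_positive_iff algebra_simps)
    also have "\<dots> = (\<Sum>y\<in>set_pmf (K x). pmf (K x) y) * (pmf p x * - log 2 (pmf p x)) +
        pmf p x * (\<Sum>y\<in>set_pmf (K x). pmf (K x) y * - log 2 (pmf (K x) y))"
      by (simp only: sum.distrib sum_distrib_left sum_distrib_right)
    also have "\<dots> = pmf p x * - log 2 (pmf p x) + pmf p x * ent (K x)"
      using sum_pmf_eq_1[OF fin(2)[OF x] order_refl]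
      by (simp add: ent_def integral_pmf_sum[OF fin(2)[OF x]] sum_negf)
    finally show "(\<Sum>y\<in>set_pmf (K x). pmf p x * pmf (K x) y * - log 2 (pmf p x * pmf (K x) y)) = \<dots>" .
  qed
  also have "\<dots> = ent p + (\<integral>x. ent (K x) \<partial>measure_pmf p)"
    unfolding ent_def[of p] integral_pmf_sum[OF fin(1)] by (simp only: sum.distrib)
  finally show ?thesis .
qed

section \<open>Conditioning and Fano's inequality\<close>

lemma sum_pmf_le_marginal:
  assumes "finite S"
  shows "(\<Sum>a\<in>S. pmf p (a, c)) \<le> pmf (map_pmf snd p) c"
proof -
  have "(\<Sum>a\<in>S. pmf p (a, c)) = (\<Sum>x\<in>S \<times> {c}. pmf p x)"
    by (rule sum.reindex_bij_witness[of _ fst "\<lambda>a. (a, c)"]) auto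
  also have "\<dots> = measure_pmf.prob p (S \<times> {c})"
    using assms by (simp add: measure_measure_pmf_finite)
  also have "\<dots> \<le> measure_pmf.prob p (snd -` {c})"
    by (intro measure_pmf.finite_measure_mono) auto
  finally show ?thesis by (simp add: pmf_map)
qed

text \<open>Conditional entropies are written as differences of joint entropies, so this says H(A|B)
  \<le> H(A|g(B)). It is Gibbs' inequality against a comparison law for (A, B), whose expected
  log-loss is H(B) + H(A, g(B)) - H(g(B)).\<close>

lemma cond_entropy_mono:
  assumes fin: "finite (set_pmf p)"
  shows "H p (\<lambda>\<omega>. (A \<omega>, B \<omega>)) - H p B
      \<le> H p (\<lambda>\<omega>. (A \<omega>, g (B \<omega>))) - H p (\<lambda>\<omega>. g (B \<omega>))"
proof -
  let ?s = "map_pmf (\<lambda>\<omega>. (A \<omega>, B \<omega>)) p"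
  let ?B = "map_pmf B p" and ?C = "map_pmf (\<lambda>\<omega>. g (B \<omega>)) p"
  let ?AC = "map_pmf (\<lambda>\<omega>. (A \<omega>, g (B \<omega>))) p"
  \<comment> \<open>the law under which \<open>A\<close> and \<open>B\<close> are conditionally independent given \<open>g B\<close>\<close>
  define r where "r = (\<lambda>(a, b). pmf ?B b * pmf ?AC (a, g b) / pmf ?C (g b))"
  have pos: "pmf ?B (B \<omega>) > 0" "pmf ?AC (A \<omega>, g (B \<omega>)) > 0" "pmf ?C (g (B \<omega>)) > 0"
    if "\<omega> \<in> set_pmf p" for \<omega> using that by (auto simp: pmf_positive_iff)
  have sub: "set_pmf ?s \<subseteq> A ` set_pmf p \<times> B ` set_pmf p" by auto
  have "(\<Sum>x\<in>set_pmf ?s. r x) \<le> (\<Sum>x\<in>A ` set_pmf p \<times> B ` set_pmf p. r x)"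
    using fin sub by (intro sum_mono2) (auto simp: r_def)
  also have "\<dots> = (\<Sum>b\<in>B ` set_pmf p. \<Sum>a\<in>A ` set_pmf p. r (a, b))"
    by (subst sum.swap) (simp add: sum.cartesian_product)
  also have "\<dots> \<le> (\<Sum>b\<in>B ` set_pmf p. pmf ?B b)"
  proof (rule sum_mono)
    fix b assume "b \<in> B ` set_pmf p"
    then have pc: "pmf ?C (g b) > 0" using pos(3) by auto
    have "(\<Sum>a\<in>A ` set_pmf p. r (a, b)) = pmf ?B b / pmf ?C (g b) * (\<Sum>a\<in>A ` set_pmf p. pmf ?AC (a, g b))"
      by (simp add: r_def sum_distrib_left field_simps)
    also have "\<dots> \<le> pmf ?B b / pmf ?C (g b) * pmf ?C (g b)"
      using sum_pmf_le_marginal[of "A ` set_pmf p" ?AC "g b"] fin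
      by (intro mult_left_mono) (auto simp: map_pmf_comp)
    finally show "(\<Sum>a\<in>A ` set_pmf p. r (a, b)) \<le> pmf ?B b" using pc by simp
  qed
  also have "\<dots> = 1" using fin by (intro sum_pmf_eq_1) auto
  finally have "ent ?s \<le> (\<integral>x. - log 2 (r x) \<partial>measure_pmf ?s)"
    using fin pos by (intro gibbs_inequality) (auto simp: r_def)
  also have "\<dots> = (\<integral>\<omega>. - log 2 (pmf ?B (B \<omega>)) + - log 2 (pmf ?AC (A \<omega>, g (B \<omega>)))
       - - log 2 (pmf ?C (g (B \<omega>))) \<partial>measure_pmf p)"
    unfolding integral_map_pmf
  proof (rule integral_pmf_cong)
    fix \<omega> assume "\<omega> \<in> set_pmf p"
    from pos[OF this] show "- log 2 (r (A \<omega>, B \<omega>)) = - log 2 (pmf ?B (B \<omega>)) +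
      - log 2 (pmf ?AC (A \<omega>, g (B \<omega>))) - - log 2 (pmf ?C (g (B \<omega>)))"
      by (simp add: r_def log_mult log_divide)
  qed
  also have "\<dots> = H p B + H p (\<lambda>\<omega>. (A \<omega>, g (B \<omega>))) - H p (\<lambda>\<omega>. g (B \<omega>))"
    unfolding H_eq using fin
    by (simp add: integrable_measure_pmf_finite)
  finally show ?thesis by simp
qed

text \<open>Gibbs' inequality against a mixture that charges one bit when the guess is right and
  \<open>1 + log 2 (card A)\<close> bits when it is wrong. The constant 1 takes the place of the
  binary entropy of the error.\<close>

lemma fano_inequality:
  assumes fin: "finite (set_pmf p)" and A: "finite A" "A \<noteq> {}"
    and WA: "\<And>\<omega>. \<omega> \<in> set_pmf p \<Longrightarrow> X \<omega> \<in> A"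
  shows "H p (\<lambda>\<omega>. (X \<omega>, V \<omega>)) - H p V
      \<le> 1 + measure_pmf.prob p {\<omega>. g (V \<omega>) \<noteq> X \<omega>} * log 2 (card A)"
proof -
  let ?s = "map_pmf (\<lambda>\<omega>. (X \<omega>, V \<omega>)) p"
  let ?V = "map_pmf V p"
  define M where "M = real (card A)"
  have M: "M \<ge> 1" using A by (simp add: M_def Suc_leI card_gt_0_iff)
  \<comment> \<open>dominated by an even mixture of the point mass at the guess and the uniform law on \<open>A\<close>\<close>
  define u where "u v x = (if g v = x then 1 / 2 else 1 / (2 * M))" for v x
  define r where "r = (\<lambda>(x, v). pmf ?V v * u v x)"
  have upos: "u v x > 0" for v x using M by (simp add: u_def)
  have pos: "pmf ?V (V \<omega>) > 0" if "\<omega> \<in> set_pmf p" for \<omega> using that by (auto simp: pmf_positive_iff)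
  have u1: "(\<Sum>x\<in>A. u v x) \<le> 1" for v
  proof -
    have "(\<Sum>x\<in>A. u v x) \<le> (\<Sum>x\<in>A. (if g v = x then 1 / 2 else 0) + 1 / (2 * M))"
      using M by (intro sum_mono) (auto simp: u_def)
    also have "\<dots> \<le> 1 / 2 + 1 / 2"
      using A M by (auto simp: sum.distrib M_def)
    finally show ?thesis by simp
  qed
  have "(\<Sum>x\<in>set_pmf ?s. r x) \<le> (\<Sum>x\<in>A \<times> V ` set_pmf p. r x)"
    using fin A WA upos[THEN less_imp_le] by (intro sum_mono2) (auto simp: r_def)
  also have "\<dots> = (\<Sum>v\<in>V ` set_pmf p. \<Sum>x\<in>A. r (x, v))"
    by (subst sum.swap) (simp add: sum.cartesian_product)
  also have "\<dots> = (\<Sum>v\<in>V ` set_pmf p. pmf ?V v * (\<Sum>x\<in>A. u v x))"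
    by (simp add: r_def sum_distrib_left)
  also have "\<dots> \<le> (\<Sum>v\<in>V ` set_pmf p. pmf ?V v * 1)"
    using u1 by (intro sum_mono mult_left_mono) auto
  also have "\<dots> = 1" using fin by (simp add: sum_pmf_eq_1)
  finally have "ent ?s \<le> (\<integral>x. - log 2 (r x) \<partial>measure_pmf ?s)"
    using fin pos upos by (intro gibbs_inequality) (auto simp: r_def)
  also have "\<dots> = (\<integral>\<omega>. - log 2 (pmf ?V (V \<omega>)) +
      (1 + indicator {\<omega>. g (V \<omega>) \<noteq> X \<omega>} \<omega> * log 2 M) \<partial>measure_pmf p)"
    unfolding integral_map_pmf
  proof (rule integral_pmf_cong)
    fix \<omega> assume w: "\<omega> \<in> set_pmf p"
    show "- log 2 (r (X \<omega>, V \<omega>)) = - log 2 (pmf ?V (V \<omega>)) +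
      (1 + indicator {\<omega>. g (V \<omega>) \<noteq> X \<omega>} \<omega> * log 2 M)"
      using pos[OF w] M by (auto simp: r_def u_def log_mult log_divide)
  qed
  also have "\<dots> = H p V + (1 + measure_pmf.prob p {\<omega>. g (V \<omega>) \<noteq> X \<omega>} * log 2 M)"
    unfolding H_eq using fin
    by (simp add: integrable_measure_pmf_finite)
  finally show ?thesis by (simp add: M_def)
qed

lemma ent_pmf_of_set:
  assumes "finite A" "A \<noteq> {}"
  shows "ent (pmf_of_set A) = log 2 (card A)"
proof -
  have "ent (pmf_of_set A) = (\<integral>x. log 2 (card A) \<partial>measure_pmf (pmf_of_set A))"
    unfolding ent_def using assms by (intro integral_pmf_cong) (simp add: log_divide)
  then show ?thesis by simp
qed

lemma ent_pair_pmf: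
  assumes "finite (set_pmf p)" "finite (set_pmf q)"
  shows "ent (pair_pmf p q) = ent p + ent q"
proof -
  have "pair_pmf p q = joint_pmf p (\<lambda>_. q)" by (simp add: joint_pmf_def pair_pmf_def map_pmf_def)
  then show ?thesis using assms by (simp add: ent_joint_pmf)
qed

lemma ent_return_pmf [simp]: "ent (return_pmf c) = 0"
  by (simp add: ent_def)

section \<open>Algebra of joint laws\<close>

lemma finite_set_joint_pmf [simp]:
  "finite (set_pmf p) \<Longrightarrow> (\<And>x. x \<in> set_pmf p \<Longrightarrow> finite (set_pmf (K x))) \<Longrightarrow> finite (set_pmf (joint_pmf p K))"
  by (simp add: set_joint_pmf)

lemma map_joint_pmf:
  "map_pmf (\<lambda>s. (B (fst s), snd s)) (joint_pmf p (\<lambda>\<omega>. K (B \<omega>))) = joint_pmf (map_pmf B p) K"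
  by (simp add: joint_pmf_def map_bind_pmf bind_map_pmf map_pmf_comp)

lemma map_snd_joint_pmf:
  "map_pmf (\<lambda>s. (fst s, F (snd s))) (joint_pmf p K) = joint_pmf p (\<lambda>\<omega>. map_pmf F (K \<omega>))"
  by (simp add: joint_pmf_def map_bind_pmf map_pmf_comp)

lemma joint_pmf_assoc:
  "joint_pmf p (\<lambda>\<omega>. joint_pmf (K \<omega>) (L \<omega>)) =
    map_pmf (\<lambda>s. (fst (fst s), (snd (fst s), snd s))) (joint_pmf (joint_pmf p K) (\<lambda>s. L (fst s) (snd s)))"
  by (simp add: joint_pmf_def map_bind_pmf bind_assoc_pmf bind_map_pmf map_pmf_comp)

text \<open>The kernel is the conditional law of the second coordinate given the first. Every
  \<open>t\<close> drawn from the marginal has positive mass, so the conditioning event is never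
  null.\<close>

lemma joint_pmf_disintegration: "\<exists>\<kappa>. q = joint_pmf (map_pmf fst q) \<kappa>"
proof
  let ?\<kappa> = "\<lambda>t. map_pmf snd (cond_pmf q {s. t = fst s})"
  have "joint_pmf (map_pmf fst q) ?\<kappa> = bind_pmf (map_pmf fst q) (\<lambda>t. cond_pmf q {s. t = fst s})"
    unfolding joint_pmf_def
  proof (rule bind_pmf_cong[OF refl])
    fix t assume "t \<in> set_pmf (map_pmf fst q)"
    then have "set_pmf q \<inter> {s. t = fst s} \<noteq> {}" by auto
    then have "map_pmf (\<lambda>s. (t, snd s)) (cond_pmf q {s. t = fst s}) = map_pmf id (cond_pmf q {s. t = fst s})"
      by (intro map_pmf_cong) (auto simp: set_cond_pmf)
    then show "map_pmf (Pair t) (map_pmf snd (cond_pmf q {s. t = fst s})) = cond_pmf q {s. t = fst s}"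
      by (simp add: map_pmf_comp)
  qed
  also have "\<dots> = q"
    by (rule bind_cond_pmf_cancel) (auto simp: pmf_map vimage_def intro!: arg_cong[where f="measure_pmf.prob q"])
  finally show "q = joint_pmf (map_pmf fst q) ?\<kappa>" ..
qed

section \<open>Conditional mutual information\<close>

text \<open>The entropy form of I(A; B | C), for variables of arbitrary type;
  \<open>cond_mutual_info_eq_cmi\<close> identifies it with the measure-theoretic notion on
  countable types.\<close>

definition cmi :: "'w pmf \<Rightarrow> ('w \<Rightarrow> 'a) \<Rightarrow> ('w \<Rightarrow> 'b) \<Rightarrow> ('w \<Rightarrow> 'c) \<Rightarrow> real" where
  "cmi p A B C = H p (\<lambda>\<omega>. (A \<omega>, C \<omega>)) + H p (\<lambda>\<omega>. (B \<omega>, C \<omega>))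
     - H p (\<lambda>\<omega>. (A \<omega>, B \<omega>, C \<omega>)) - H p C"

lemma cmi_map: "cmi (map_pmf f p) A B C = cmi p (\<lambda>\<omega>. A (f \<omega>)) (\<lambda>\<omega>. B (f \<omega>)) (\<lambda>\<omega>. C (f \<omega>))"
  by (simp add: cmi_def map_pmf_comp)

lemma cmi_cong:
  assumes "\<And>\<omega>. \<omega> \<in> set_pmf p \<Longrightarrow> C \<omega> = C' \<omega>"
  shows "cmi p A B C = cmi p A B C'"
proof -
  have "H p (\<lambda>\<omega>. h \<omega> (C \<omega>)) = H p (\<lambda>\<omega>. h \<omega> (C' \<omega>))" for h :: "'a \<Rightarrow> 'b \<Rightarrow> 'x"
    using assms by (intro arg_cong[where f=ent] map_pmf_cong) simp_all
  from this[of "\<lambda>\<omega> c. (A \<omega>, c)"] this[of "\<lambda>\<omega> c. (B \<omega>, c)"] this[of "\<lambda>\<omega> c. (A \<omega>, B \<omega>, c)"]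
    this[of "\<lambda>\<omega> c. c"]
  show ?thesis unfolding cmi_def by (simp only:)
qed

lemma cmi_inj:
  assumes "inj f"
  shows "cmi p A B (\<lambda>\<omega>. f (C \<omega>)) = cmi p A B C"
proof -
  have "H p (\<lambda>\<omega>. (A \<omega>, f (C \<omega>))) = H p (\<lambda>\<omega>. (A \<omega>, C \<omega>))"
    by (rule H_inj[of "map_prod id f"]) (auto intro!: inj_onI dest: injD[OF assms])
  moreover have "H p (\<lambda>\<omega>. (B \<omega>, f (C \<omega>))) = H p (\<lambda>\<omega>. (B \<omega>, C \<omega>))"
    by (rule H_inj[of "map_prod id f"]) (auto intro!: inj_onI dest: injD[OF assms])
  moreover have "H p (\<lambda>\<omega>. (A \<omega>, B \<omega>, f (C \<omega>))) = H p (\<lambda>\<omega>. (A \<omega>, B \<omega>, C \<omega>))"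
    by (rule H_inj[of "map_prod id (map_prod id f)"]) (auto intro!: inj_onI dest: injD[OF assms])
  moreover have "H p (\<lambda>\<omega>. f (C \<omega>)) = H p C"
    by (rule H_inj[of f]) (auto intro!: inj_onI dest: injD[OF assms])
  ultimately show ?thesis by (simp add: cmi_def)
qed

text \<open>I(A; B | C) = H(A|C) - H(A|B, C), and \<open>C\<close> is a function of
  \<open>(B, C)\<close>.\<close>

lemma cmi_nonneg:
  assumes "finite (set_pmf p)"
  shows "0 \<le> cmi p A B C"
  using cond_entropy_mono[OF assms, of A "\<lambda>\<omega>. (B \<omega>, C \<omega>)" snd] by (simp add: cmi_def)

lemma H_time_sharing:
  assumes "finite (set_pmf \<mu>)" "\<And>t. t \<in> set_pmf \<mu> \<Longrightarrow> finite (set_pmf (\<rho> t))"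
  shows "H (joint_pmf \<mu> \<rho>) (\<lambda>s. (X (snd s), fst s)) = ent \<mu> + (\<integral>t. H (\<rho> t) X \<partial>measure_pmf \<mu>)"
proof -
  have "H (joint_pmf \<mu> \<rho>) (\<lambda>s. (X (snd s), fst s)) = H (joint_pmf \<mu> \<rho>) (\<lambda>s. (fst s, X (snd s)))"
    by (rule H_inj[of prod.swap]) auto
  also have "\<dots> = ent \<mu> + (\<integral>t. H (\<rho> t) X \<partial>measure_pmf \<mu>)"
    unfolding map_snd_joint_pmf using assms by (subst ent_joint_pmf) auto
  finally show ?thesis .
qed

text \<open>By the chain rule each of the four joint entropies contains \<open>ent \<mu>\<close>
  once. These terms cancel, which leaves the average of the informations at fixed
  \<open>t\<close>.\<close>

lemma cmi_time_sharing:
  assumes "finite (set_pmf \<mu>)" "\<And>t. t \<in> set_pmf \<mu> \<Longrightarrow> finite (set_pmf (\<rho> t))"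
  shows "cmi (joint_pmf \<mu> \<rho>) (\<lambda>s. A (snd s)) (\<lambda>s. B (snd s)) (\<lambda>s. (C (snd s), fst s)) =
    (\<integral>t. cmi (\<rho> t) A B C \<partial>measure_pmf \<mu>)"
proof -
  have 1: "H (joint_pmf \<mu> \<rho>) (\<lambda>s. (X (snd s), C (snd s), fst s)) =
    H (joint_pmf \<mu> \<rho>) (\<lambda>s. ((X (snd s), C (snd s)), fst s))" for X :: "'b \<Rightarrow> 'x"
    by (rule H_inj[of "\<lambda>((a, b), c). (a, b, c)"]) (auto intro!: inj_onI)
  have 2: "H (joint_pmf \<mu> \<rho>) (\<lambda>s. (A (snd s), B (snd s), C (snd s), fst s)) =
    H (joint_pmf \<mu> \<rho>) (\<lambda>s. ((A (snd s), B (snd s), C (snd s)), fst s))"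
    by (rule H_inj[of "\<lambda>((a, b, c), d). (a, b, c, d)"]) (auto intro!: inj_onI)
  show ?thesis
    unfolding cmi_def 1 2
    using H_time_sharing[where \<rho>=\<rho> and X=C, OF assms] H_time_sharing[where \<rho>=\<rho> and X="\<lambda>\<omega>. (A \<omega>, C \<omega>)", OF assms]
      H_time_sharing[where \<rho>=\<rho> and X="\<lambda>\<omega>. (B \<omega>, C \<omega>)", OF assms] H_time_sharing[where \<rho>=\<rho> and X="\<lambda>\<omega>. (A \<omega>, B \<omega>, C \<omega>)", OF assms] assms(1)
    by (simp add: integrable_measure_pmf_finite)
qed

lemma cmi_time_sharing_unit:
  assumes "finite (set_pmf \<mu>)" "\<And>t. t \<in> set_pmf \<mu> \<Longrightarrow> finite (set_pmf (\<rho> t))"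
  shows "cmi (joint_pmf \<mu> \<rho>) (\<lambda>s. A (snd s)) (\<lambda>s. B (snd s)) fst =
    (\<integral>t. cmi (\<rho> t) A B (\<lambda>_. ()) \<partial>measure_pmf \<mu>)"
  using cmi_time_sharing[where \<rho>=\<rho> and A=A and B=B and C="\<lambda>_. ()", OF assms] cmi_inj[of "Pair ()" "joint_pmf \<mu> \<rho>" "\<lambda>s. A (snd s)" "\<lambda>s. B (snd s)" fst]
  by (simp add: inj_def)

text \<open>The kernel factors through \<open>B\<close>, so the chain rule applies to the law of
  \<open>B\<close>. If several choices of \<open>B\<close> determine the same channel input, the
  output has the same conditional entropy given each of them; this is how memorylessness is
  used.\<close>

lemma H_cond_kernel:
  assumes fin: "finite (set_pmf p)" "\<And>x. finite (set_pmf (V x))"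
  shows "H (joint_pmf p (\<lambda>\<omega>. V (\<phi> (B \<omega>)))) (\<lambda>s. (B (fst s), F (snd s)))
      - H (joint_pmf p (\<lambda>\<omega>. V (\<phi> (B \<omega>)))) (\<lambda>s. B (fst s))
     = (\<integral>\<omega>. ent (map_pmf F (V (\<phi> (B \<omega>)))) \<partial>measure_pmf p)"
proof -
  let ?J = "joint_pmf p (\<lambda>\<omega>. V (\<phi> (B \<omega>)))"
  have "map_pmf (\<lambda>s. (B (fst s), F (snd s))) ?J =
     map_pmf (\<lambda>s. (B (fst s), snd s)) (joint_pmf p (\<lambda>\<omega>. map_pmf F (V (\<phi> (B \<omega>)))))"
    unfolding map_snd_joint_pmf[symmetric] by (simp add: map_pmf_comp)
  also have "\<dots> = joint_pmf (map_pmf B p) (\<lambda>b. map_pmf F (V (\<phi> b)))"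
    by (rule map_joint_pmf)
  finally have 1: "H ?J (\<lambda>s. (B (fst s), F (snd s))) =
     ent (joint_pmf (map_pmf B p) (\<lambda>b. map_pmf F (V (\<phi> b))))" by simp
  have "map_pmf (\<lambda>s. B (fst s)) ?J = map_pmf B p"
    using map_fst_joint_pmf[of p] by (metis map_pmf_comp)
  then show ?thesis using fin by (simp add: 1 ent_joint_pmf)
qed

text \<open>The second output is produced from the first alone. Given the first output, it therefore
  contributes an entropy that is the same for every \<open>B\<close>.\<close>

lemma H_channel_split:
  fixes X :: "'a \<Rightarrow> 'x"
  assumes fin: "finite (set_pmf p)" "\<And>x. finite (set_pmf (P x))" "\<And>y. finite (set_pmf (Q y))"
  defines "J \<equiv> joint_pmf p (\<lambda>\<omega>. joint_pmf (P (X \<omega>)) Q)"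
  shows "H J (\<lambda>s. (B (fst s), snd s)) = H J (\<lambda>s. (B (fst s), fst (snd s)))
     + (\<integral>s. ent (Q (fst (snd s))) \<partial>measure_pmf J)"
proof -
  let ?q = "joint_pmf p (\<lambda>\<omega>. P (X \<omega>))"
  have J: "J = map_pmf (\<lambda>s. (fst (fst s), (snd (fst s), snd s))) (joint_pmf ?q (\<lambda>s. Q (snd s)))"
    unfolding J_def by (rule joint_pmf_assoc[where L="\<lambda>_. Q"])
  have fq: "finite (set_pmf ?q)" using fin by simp
  have f: "map_pmf fst (joint_pmf ?q (\<lambda>s. Q (snd s))) = ?q" by (rule map_fst_joint_pmf)
  have "H J (\<lambda>s. (B (fst s), snd s)) = H (joint_pmf ?q (\<lambda>s. Q (snd s)))
      (\<lambda>s. ((B (fst (fst s)), snd (fst s)), snd s))"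
    unfolding J map_pmf_comp
    by (rule H_inj[of "\<lambda>((a, b), c). (a, b, c)"]) (auto intro!: inj_onI)
  also have "\<dots> = H (joint_pmf ?q (\<lambda>s. Q (snd s))) (\<lambda>s. (B (fst (fst s)), snd (fst s)))
      + (\<integral>s. ent (Q (snd s)) \<partial>measure_pmf ?q)"
    using H_cond_kernel[where V=Q and \<phi>=snd and B="\<lambda>s. (B (fst s), snd s)" and F="\<lambda>y. y", OF fq fin(3)] by simp
  also have "(\<integral>s. ent (Q (snd s)) \<partial>measure_pmf ?q) = (\<integral>s. ent (Q (fst (snd s))) \<partial>measure_pmf J)"
    by (subst f[symmetric]) (simp add: J)
  finally show ?thesis by (simp add: J map_pmf_comp)
qed

text \<open>With Z = (Y, F), the left side is H(Z|B) - H(Z|past). The feedback F contributes equally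
  to both terms, so Z may be replaced by Y. Then H(Y|B) \<le> H(Y|C), as \<open>C\<close> is a
  function of \<open>B\<close>, while H(Y|past) = H(Y|A, C), as both determine the channel
  input.\<close>

lemma information_step:
  fixes P :: "'x \<Rightarrow> 'y pmf" and Q :: "'y \<Rightarrow> 'f pmf" and p :: "'w pmf"
  assumes fin: "finite (set_pmf p)" "\<And>x. finite (set_pmf (P x))" "\<And>y. finite (set_pmf (Q y))"
    and X: "\<And>\<omega>. X \<omega> = \<phi> (A \<omega>, C \<omega>)" and C: "\<And>\<omega>. C \<omega> = g (B \<omega>)"
  defines "J \<equiv> joint_pmf p (\<lambda>\<omega>. joint_pmf (P (X \<omega>)) Q)"
  shows "(H J (\<lambda>s. (B (fst s), snd s)) - H J (\<lambda>s. B (fst s))) - (ent J - H J fst)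
     \<le> cmi J (\<lambda>s. A (fst s)) (\<lambda>s. fst (snd s)) (\<lambda>s. C (fst s))"
proof -
  let ?Y = "\<lambda>s :: 'w \<times> 'y \<times> 'f. fst (snd s)"
  have fJ: "finite (set_pmf J)" using fin by (simp add: J_def)
  have fV: "finite (set_pmf (joint_pmf (P x) Q))" for x using fin by simp
  have 1: "H J (\<lambda>s. (B (fst s), snd s)) - H J (\<lambda>s. (B (fst s), ?Y s)) =
      ent J - H J (\<lambda>s. (fst s, ?Y s))"
    using H_channel_split[where P=P and Q=Q and X=X and p=p, OF fin, where B=B] H_channel_split[where P=P and Q=Q and X=X and p=p, OF fin, where B="\<lambda>\<omega>. \<omega>"] by (simp add: J_def)
  have 2: "H J (\<lambda>s. (fst s, ?Y s)) - H J fst = (\<integral>\<omega>. ent (map_pmf fst (joint_pmf (P (X \<omega>)) Q)) \<partial>measure_pmf p)"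
    using H_cond_kernel[where V="\<lambda>x. joint_pmf (P x) Q" and \<phi>=X and B="\<lambda>\<omega>. \<omega>" and F=fst, OF fin(1) fV] by (simp add: J_def)
  have 3: "H J (\<lambda>s. ((A (fst s), C (fst s)), ?Y s)) - H J (\<lambda>s. (A (fst s), C (fst s))) = (\<integral>\<omega>. ent (map_pmf fst (joint_pmf (P (X \<omega>)) Q)) \<partial>measure_pmf p)"
    using H_cond_kernel[where V="\<lambda>x. joint_pmf (P x) Q" and \<phi>=\<phi> and B="\<lambda>\<omega>. (A \<omega>, C \<omega>)" and F=fst, OF fin(1) fV] by (simp add: J_def X)
  have 4: "H J (\<lambda>s. (A (fst s), ?Y s, C (fst s))) = H J (\<lambda>s. ((A (fst s), C (fst s)), ?Y s))"
    by (rule H_inj[of "\<lambda>((a, c), y). (a, y, c)"]) (auto intro!: inj_onI)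
  have 5: "H J (\<lambda>s. (?Y s, B (fst s))) - H J (\<lambda>s. B (fst s)) \<le> H J (\<lambda>s. (?Y s, C (fst s))) - H J (\<lambda>s. C (fst s))"
    unfolding C by (rule cond_entropy_mono[OF fJ])
  have 6: "H J (\<lambda>s. (?Y s, B (fst s))) = H J (\<lambda>s. (B (fst s), ?Y s))"
    by (rule H_inj[of prod.swap]) auto
  show ?thesis using 1 2 3 4 5 6 by (simp add: cmi_def)
qed

text \<open>The left side equals H(F|W, T) + H(F|W', T) - H(F|W, W', T) - H(F|T), and the right side
  is the same expression in the inputs. Replacing messages by inputs raises the first two terms and
  leaves the other two unchanged.\<close>

lemma dependence_step:
  assumes fin: "finite (set_pmf p)" "\<And>x. finite (set_pmf (V x))"
    and X: "\<And>\<omega>. X1 \<omega> = \<phi> (W \<omega>, T \<omega>)" "\<And>\<omega>. X2 \<omega> = \<psi> (W' \<omega>, T \<omega>)"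
  defines "J \<equiv> joint_pmf p (\<lambda>\<omega>. V (X1 \<omega>, X2 \<omega>))"
  shows "cmi J (\<lambda>s. W (fst s)) (\<lambda>s. W' (fst s)) (\<lambda>s. (F (snd s), T (fst s)))
       - cmi J (\<lambda>s. W (fst s)) (\<lambda>s. W' (fst s)) (\<lambda>s. T (fst s))
    \<le> cmi J (\<lambda>s. X1 (fst s)) (\<lambda>s. X2 (fst s)) (\<lambda>s. (F (snd s), T (fst s)))
       - cmi J (\<lambda>s. X1 (fst s)) (\<lambda>s. X2 (fst s)) (\<lambda>s. T (fst s))"
proof -
  have fJ: "finite (set_pmf J)" using fin by (simp add: J_def)
  \<comment> \<open>\<open>(X, T)\<close> is a function of \<open>(W, T)\<close>, so conditioning on
    it is coarser; the inequality is rearranged from H(F|W, T) \<le> H(F|X, T).\<close>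
  have mono: "H J (\<lambda>s. (W (fst s), F (snd s), T (fst s))) - H J (\<lambda>s. (W (fst s), T (fst s)))
    \<le> H J (\<lambda>s. (X (fst s), F (snd s), T (fst s))) - H J (\<lambda>s. (X (fst s), T (fst s)))"
    if X: "\<And>\<omega>. X \<omega> = \<phi> (W \<omega>, T \<omega>)" for X :: "'a \<Rightarrow> 'x" and W :: "'a \<Rightarrow> 'w" and \<phi>
  proof -
    have "H J (\<lambda>s. (F (snd s), W (fst s), T (fst s))) - H J (\<lambda>s. (W (fst s), T (fst s)))
      \<le> H J (\<lambda>s. (F (snd s), X (fst s), T (fst s))) - H J (\<lambda>s. (X (fst s), T (fst s)))"
      using cond_entropy_mono[OF fJ, of "\<lambda>s. F (snd s)" "\<lambda>s. (W (fst s), T (fst s))" "\<lambda>b. (\<phi> b, snd b)"]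
      by (simp add: X)
    moreover have "H J (\<lambda>s. (F (snd s), W (fst s), T (fst s))) = H J (\<lambda>s. (W (fst s), F (snd s), T (fst s)))"
      by (rule H_inj[of "\<lambda>(a, b, c). (b, a, c)"]) (auto intro!: inj_onI)
    moreover have "H J (\<lambda>s. (F (snd s), X (fst s), T (fst s))) = H J (\<lambda>s. (X (fst s), F (snd s), T (fst s)))"
      by (rule H_inj[of "\<lambda>(a, b, c). (b, a, c)"]) (auto intro!: inj_onI)
    ultimately show ?thesis by simp
  qed
  \<comment> \<open>Stated for any pair that determines the channel inputs together with
    \<open>T\<close>, in order to cover both the messages and the inputs themselves.\<close>
  have eq: "H J (\<lambda>s. (U1 (fst s), U2 (fst s), F (snd s), T (fst s))) - H J (\<lambda>s. (U1 (fst s), U2 (fst s), T (fst s)))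
    = (\<integral>\<omega>. ent (map_pmf F (V (X1 \<omega>, X2 \<omega>))) \<partial>measure_pmf p)"
    if X: "\<And>\<omega>. X1 \<omega> = \<psi>1 (U1 \<omega>, T \<omega>)" "\<And>\<omega>. X2 \<omega> = \<psi>2 (U2 \<omega>, T \<omega>)"
    for U1 :: "'a \<Rightarrow> 'u" and U2 :: "'a \<Rightarrow> 'v" and \<psi>1 \<psi>2
  proof -
    have "H J (\<lambda>s. (U1 (fst s), U2 (fst s), F (snd s), T (fst s))) = H J (\<lambda>s. ((U1 (fst s), U2 (fst s), T (fst s)), F (snd s)))"
      by (rule H_inj[of "\<lambda>((a, b, c), d). (a, b, d, c)"]) (auto intro!: inj_onI)
    then show ?thesis
      using H_cond_kernel[where V=V and \<phi>="\<lambda>(a, b, c). (\<psi>1 (a, c), \<psi>2 (b, c))" and B="\<lambda>\<omega>. (U1 \<omega>, U2 \<omega>, T \<omega>)" and F=F, OF fin]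
      by (simp add: X J_def)
  qed
  show ?thesis
    using mono[of X1 \<phi> W, OF X(1)] mono[of X2 \<psi> W', OF X(2)]
      eq[of \<phi> W \<psi> W', OF X] eq[of fst X1 fst X2]
    by (simp add: cmi_def)
qed

section \<open>Agreement with measure-theoretic mutual information\<close>

lemma distributed_measure_pmf:
  "distributed (measure_pmf p) (count_space UNIV) A (\<lambda>x. ennreal (pmf (map_pmf A p) x))"
  unfolding distributed_def
  by (simp add: map_pmf_rep_eq[symmetric] measure_pmf_eq_density[symmetric])

lemma count_space_pair:
  "count_space (UNIV :: 'a :: countable set) \<Otimes>\<^sub>M count_space (UNIV :: 'b :: countable set) = count_space UNIV"
  using pair_measure_countable[of "UNIV :: 'a set" "UNIV :: 'b set"] by simp

lemma mutual_information_pmf: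
  fixes A :: "'w \<Rightarrow> 'a :: countable" and B :: "'w \<Rightarrow> 'b :: countable"
  assumes fin: "finite (set_pmf p)"
  shows "prob_space.mutual_information (measure_pmf p) 2 (count_space UNIV) (count_space UNIV) A B =
    H p A + H p B - H p (\<lambda>\<omega>. (A \<omega>, B \<omega>))"
proof -
  interpret information_space "measure_pmf p" "2 :: real"
    by (intro information_space.intro information_space_axioms.intro prob_space_measure_pmf) simp
  let ?A = "map_pmf A p" and ?B = "map_pmf B p" and ?AB = "map_pmf (\<lambda>\<omega>. (A \<omega>, B \<omega>)) p"
  let ?l = "\<lambda>x. log 2 (pmf ?AB x / (pmf ?A (fst x) * pmf ?B (snd x)))"
  have "prob_space.mutual_information (measure_pmf p) 2 (count_space UNIV) (count_space UNIV) A B =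
    (\<integral>x. pmf ?AB x * ?l x \<partial>(count_space UNIV \<Otimes>\<^sub>M count_space UNIV))"
  proof -
    have S: "sigma_finite_measure (count_space (UNIV :: 'a set))" "sigma_finite_measure (count_space (UNIV :: 'b set))"
      by (simp_all add: sigma_finite_measure_count_space)
    have AB: "distributed (measure_pmf p) (count_space UNIV \<Otimes>\<^sub>M count_space UNIV) (\<lambda>x. (A x, B x)) (\<lambda>x. ennreal (pmf ?AB x))"
      unfolding count_space_pair by (rule distributed_measure_pmf)
    show ?thesis
      using mutual_information_distr[OF S distributed_measure_pmf pmf_nonneg distributed_measure_pmf pmf_nonneg AB pmf_nonneg] .
  qed
  also have "\<dots> = (\<integral>x. ?l x \<partial>measure_pmf ?AB)"
    unfolding count_space_pair measure_pmf_eq_density[of ?AB]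
    by (subst integral_density) auto
  also have "\<dots> = (\<integral>\<omega>. - log 2 (pmf ?A (A \<omega>)) + - log 2 (pmf ?B (B \<omega>)) - - log 2 (pmf ?AB (A \<omega>, B \<omega>)) \<partial>measure_pmf p)"
    unfolding integral_map_pmf
  proof (rule integral_pmf_cong)
    fix \<omega> assume "\<omega> \<in> set_pmf p"
    then have "pmf ?A (A \<omega>) > 0" "pmf ?B (B \<omega>) > 0" "pmf ?AB (A \<omega>, B \<omega>) > 0"
      by (auto simp: pmf_positive_iff)
    then show "?l (A \<omega>, B \<omega>) = - log 2 (pmf ?A (A \<omega>)) + - log 2 (pmf ?B (B \<omega>)) - - log 2 (pmf ?AB (A \<omega>, B \<omega>))"
      by (simp add: log_mult log_divide)
  qed
  also have "\<dots> = H p A + H p B - H p (\<lambda>\<omega>. (A \<omega>, B \<omega>))"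
    unfolding H_eq using fin by (simp add: integrable_measure_pmf_finite)
  finally show ?thesis .
qed

text \<open>By definition the left side is I(A; (B, C)) - I(A; C), where H(A) cancels.\<close>

lemma cond_mutual_info_eq_cmi:
  fixes A :: "'w \<Rightarrow> 'a :: countable" and B :: "'w \<Rightarrow> 'b :: countable" and C :: "'w \<Rightarrow> 'c :: countable"
  assumes "finite (set_pmf p)"
  shows "prob_space.conditional_mutual_information (measure_pmf p) 2
      (count_space UNIV) (count_space UNIV) (count_space UNIV) A B C = cmi p A B C"
  unfolding prob_space.conditional_mutual_information_def[OF prob_space_measure_pmf] count_space_pair
  by (simp add: mutual_information_pmf[OF assms] cmi_def)

section \<open>The single-letter region\<close>

text \<open>The three rate bounds and the slack in the dependence balance bound, for a fixed value
  of T and input law \<open>q\<close>. With the slack as a fourth coordinate, every constraint of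
  the region becomes linear in the average over T.\<close>

definition single_letter ::
  "('x1 \<times> 'x2 \<Rightarrow> ('y \<times> 'f) pmf) \<Rightarrow> ('x1 \<times> 'x2) pmf \<Rightarrow> real \<times> real \<times> real \<times> real" where
  "single_letter V q = (let r = joint_pmf q V;
      X1 = (\<lambda>s. fst (fst s)); X2 = (\<lambda>s. snd (fst s)); Y = (\<lambda>s. fst (snd s)); F = (\<lambda>s. snd (snd s))
    in (cmi r X1 Y X2, cmi r X2 Y X1, cmi r fst Y (\<lambda>_. ()),
        cmi r X1 X2 F - cmi r X1 X2 (\<lambda>_. ())))"

text \<open>The bridge between conditioning on T and convex combinations. It is used in both
  directions: to place the informations of a code in the hull, and to realise a point of the hull by
  random variables.\<close>

lemma single_letter_time_sharing:
  assumes fin: "finite (set_pmf \<mu>)" "\<And>t. t \<in> set_pmf \<mu> \<Longrightarrow> finite (set_pmf (\<kappa> t))" "\<And>x. finite (set_pmf (V x))"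
  defines "K \<equiv> joint_pmf \<mu> (\<lambda>t. joint_pmf (\<kappa> t) V)"
    and "X1 \<equiv> \<lambda>s. fst (fst (snd s))" and "X2 \<equiv> \<lambda>s. snd (fst (snd s))"
    and "Y \<equiv> \<lambda>s. fst (snd (snd s))" and "F \<equiv> \<lambda>s. snd (snd (snd s))"
  shows "(cmi K X1 Y (\<lambda>s. (X2 s, fst s)), cmi K X2 Y (\<lambda>s. (X1 s, fst s)), cmi K (\<lambda>s. fst (snd s)) Y fst,
      cmi K X1 X2 (\<lambda>s. (F s, fst s)) - cmi K X1 X2 fst)
    = (\<Sum>t\<in>set_pmf \<mu>. pmf \<mu> t *\<^sub>R single_letter V (\<kappa> t))"
proof -
  have fK: "\<And>t. t \<in> set_pmf \<mu> \<Longrightarrow> finite (set_pmf (joint_pmf (\<kappa> t) V))" using fin by simp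
  note time = cmi_time_sharing[where \<rho>="\<lambda>t. joint_pmf (\<kappa> t) V", OF fin(1) fK]
    and unit = cmi_time_sharing_unit[where \<rho>="\<lambda>t. joint_pmf (\<kappa> t) V", OF fin(1) fK]
  have 1: "cmi K X1 Y (\<lambda>s. (X2 s, fst s)) =
      (\<Sum>t\<in>set_pmf \<mu>. pmf \<mu> t * fst (single_letter V (\<kappa> t)))"
    using time[where A="\<lambda>s. fst (fst s)" and B="\<lambda>s. fst (snd s)" and C="\<lambda>s. snd (fst s)"]
    by (simp add: K_def X1_def X2_def Y_def single_letter_def Let_def integral_pmf_sum[OF fin(1)])
  have 2: "cmi K X2 Y (\<lambda>s. (X1 s, fst s)) =
      (\<Sum>t\<in>set_pmf \<mu>. pmf \<mu> t * fst (snd (single_letter V (\<kappa> t))))"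
    using time[where A="\<lambda>s. snd (fst s)" and B="\<lambda>s. fst (snd s)" and C="\<lambda>s. fst (fst s)"]
    by (simp add: K_def X1_def X2_def Y_def single_letter_def Let_def integral_pmf_sum[OF fin(1)])
  have 3: "cmi K (\<lambda>s. fst (snd s)) Y fst =
      (\<Sum>t\<in>set_pmf \<mu>. pmf \<mu> t * fst (snd (snd (single_letter V (\<kappa> t)))))"
    using unit[where A=fst and B="\<lambda>s. fst (snd s)"]
    by (simp add: K_def Y_def single_letter_def Let_def integral_pmf_sum[OF fin(1)])
  have 4: "cmi K X1 X2 (\<lambda>s. (F s, fst s)) - cmi K X1 X2 fst =
      (\<Sum>t\<in>set_pmf \<mu>. pmf \<mu> t * snd (snd (snd (single_letter V (\<kappa> t)))))"
    using time[where A="\<lambda>s. fst (fst s)" and B="\<lambda>s. snd (fst s)" and C="\<lambda>s. snd (snd s)"]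
      unit[where A="\<lambda>s. fst (fst s)" and B="\<lambda>s. snd (fst s)"]
    by (simp add: K_def X1_def X2_def F_def single_letter_def Let_def integral_pmf_sum[OF fin(1)]
        sum_subtractf right_diff_distrib)
  show ?thesis
    unfolding 1 2 3 4 by (intro prod_eqI) (simp_all add: fst_sum snd_sum)
qed

text \<open>Disintegrating the law of \<open>(T, (X1, X2))\<close> gives a law of T and conditional
  input laws, and the channel then acts separately for each value of T. The type of \<open>T\<close>
  is arbitrary, so T can be a whole feedback history.\<close>

lemma single_letter_average:
  fixes X1 :: "'w \<Rightarrow> 'x1" and X2 :: "'w \<Rightarrow> 'x2"
  assumes fin: "finite (set_pmf p)" "\<And>x. finite (set_pmf (V x))"
  defines "J \<equiv> joint_pmf p (\<lambda>\<omega>. V (X1 \<omega>, X2 \<omega>))"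
  shows "(cmi J (\<lambda>s. X1 (fst s)) (\<lambda>s. fst (snd s)) (\<lambda>s. (X2 (fst s), T (fst s))),
     cmi J (\<lambda>s. X2 (fst s)) (\<lambda>s. fst (snd s)) (\<lambda>s. (X1 (fst s), T (fst s))),
     cmi J (\<lambda>s. (X1 (fst s), X2 (fst s))) (\<lambda>s. fst (snd s)) (\<lambda>s. T (fst s)),
     cmi J (\<lambda>s. X1 (fst s)) (\<lambda>s. X2 (fst s)) (\<lambda>s. (snd (snd s), T (fst s))) -
     cmi J (\<lambda>s. X1 (fst s)) (\<lambda>s. X2 (fst s)) (\<lambda>s. T (fst s)))
    \<in> convex hull (range (single_letter V))"
proof -
  let ?q = "map_pmf (\<lambda>\<omega>. (T \<omega>, (X1 \<omega>, X2 \<omega>))) p"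
  obtain \<mu> \<kappa> where q: "?q = joint_pmf \<mu> \<kappa>" using joint_pmf_disintegration by blast
  have fq: "finite (set_pmf (joint_pmf \<mu> \<kappa>))" unfolding q[symmetric] using fin by simp
  have "set_pmf \<mu> = fst ` set_pmf (joint_pmf \<mu> \<kappa>)"
    using arg_cong[OF map_fst_joint_pmf[of \<mu> \<kappa>], of set_pmf] by simp
  then have f\<mu>: "finite (set_pmf \<mu>)" using fq by simp
  have f\<kappa>: "finite (set_pmf (\<kappa> t))" if "t \<in> set_pmf \<mu>" for t
  proof -
    have "Pair t ` set_pmf (\<kappa> t) \<subseteq> set_pmf (joint_pmf \<mu> \<kappa>)" using that by (auto simp: set_joint_pmf)
    then have "finite (Pair t ` set_pmf (\<kappa> t))" using fq finite_subset by blast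
    then show ?thesis by (rule finite_imageD) (simp add: inj_on_def)
  qed
  \<comment> \<open>The channel sees \<open>(T, (X1, X2))\<close> only through the inputs; after
    rebracketing, the law of T, inputs and outputs is the time-sharing law.\<close>
  have "map_pmf (\<lambda>s. (T (fst s), ((X1 (fst s), X2 (fst s)), snd s))) J =
    map_pmf (\<lambda>s. (fst (fst s), (snd (fst s), snd s)))
      (map_pmf (\<lambda>s. ((T (fst s), (X1 (fst s), X2 (fst s))), snd s)) J)"
    by (simp add: map_pmf_comp)
  also have "map_pmf (\<lambda>s. ((T (fst s), (X1 (fst s), X2 (fst s))), snd s)) J = joint_pmf ?q (\<lambda>x. V (snd x))"
    unfolding J_def map_joint_pmf[symmetric] by simp
  finally have K: "map_pmf (\<lambda>s. (T (fst s), ((X1 (fst s), X2 (fst s)), snd s))) J =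
     joint_pmf \<mu> (\<lambda>t. joint_pmf (\<kappa> t) V)"
    unfolding q joint_pmf_assoc[where L="\<lambda>_. V"] .
  have "(\<Sum>t\<in>set_pmf \<mu>. pmf \<mu> t *\<^sub>R single_letter V (\<kappa> t)) \<in> convex hull (range (single_letter V))"
    using f\<mu> by (intro convex_sum) (auto intro: hull_inc simp: sum_pmf_eq_1)
  also have "(\<Sum>t\<in>set_pmf \<mu>. pmf \<mu> t *\<^sub>R single_letter V (\<kappa> t)) =
    (cmi J (\<lambda>s. X1 (fst s)) (\<lambda>s. fst (snd s)) (\<lambda>s. (X2 (fst s), T (fst s))),
     cmi J (\<lambda>s. X2 (fst s)) (\<lambda>s. fst (snd s)) (\<lambda>s. (X1 (fst s), T (fst s))),
     cmi J (\<lambda>s. (X1 (fst s), X2 (fst s))) (\<lambda>s. fst (snd s)) (\<lambda>s. T (fst s)),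
     cmi J (\<lambda>s. X1 (fst s)) (\<lambda>s. X2 (fst s)) (\<lambda>s. (snd (snd s), T (fst s))) -
     cmi J (\<lambda>s. X1 (fst s)) (\<lambda>s. X2 (fst s)) (\<lambda>s. T (fst s)))"
    by (subst single_letter_time_sharing[where \<mu>=\<mu> and \<kappa>=\<kappa> and V=V, OF f\<mu> f\<kappa> fin(2), symmetric])
      (simp_all add: K[symmetric] cmi_map)
  finally show ?thesis .
qed

section \<open>Continuity in the input law and compactness\<close>

lemma continuous_on_entropy_term: "continuous_on {0..} (\<lambda>x::real. x * log 2 x)"
proof -
  \<comment> \<open>Continuity at 0 is the delicate case: substituting 1/x turns it into ln t / t
    tending to 0 at infinity. The value at 0 is 0 because of the factor \<open>x\<close>.\<close>
  have "((\<lambda>x::real. ln (inverse x) / inverse x) \<longlongrightarrow> 0) (at_right 0)"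
    by (rule filterlim_compose[OF ln_x_over_x_tendsto_0 filterlim_inverse_at_top_right])
  from tendsto_mult_right_zero[OF this, of "- inverse (ln 2)"]
  have "((\<lambda>x::real. - (ln (inverse x) / inverse x) / ln 2) \<longlongrightarrow> 0) (at_right 0)"
    by (simp add: divide_inverse mult.commute)
  moreover have "\<forall>\<^sub>F x::real in at_right 0. - (ln (inverse x) / inverse x) / ln 2 = x * log 2 x"
    using eventually_at_right_less by eventually_elim (auto simp: ln_inverse log_def divide_inverse)
  ultimately have "((\<lambda>x::real. x * log 2 x) \<longlongrightarrow> 0) (at_right 0)"
    using filterlim_cong[OF refl refl] by fastforce
  moreover have "at 0 within {0..} = at_right (0::real)"
    unfolding at_within_def by (rule arg_cong[where f="\<lambda>S. inf (nhds 0) (principal S)"]) auto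
  ultimately have 0: "continuous (at 0 within {0..}) (\<lambda>x::real. x * log 2 x)"
    by (simp add: continuous_within)
  show ?thesis
    unfolding continuous_on_eq_continuous_within
  proof
    fix x :: real assume "x \<in> {0..}"
    then consider "x = 0" | "x > 0" by force
    then show "continuous (at x within {0..}) (\<lambda>x. x * log 2 x)"
    proof cases
      case 2
      then show ?thesis unfolding continuous_within log_def by (auto intro!: tendsto_intros)
    qed (use 0 in simp)
  qed
qed

definition prob_simplex :: "(real ^ 'n) set" where
  "prob_simplex = {v. (\<forall>i. 0 \<le> v $ i) \<and> (\<Sum>i\<in>UNIV. v $ i) = 1}"

lemma compact_prob_simplex: "compact prob_simplex"
proof -
  have "norm v \<le> 1" if "v \<in> prob_simplex" for v :: "real ^ 'n"
    using norm_le_l1_cart[of v] that by (simp add: prob_simplex_def)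
  then have "bounded (prob_simplex :: (real ^ 'n) set)" by (auto simp: bounded_iff)
  moreover have "closed (prob_simplex :: (real ^ 'n) set)"
    unfolding prob_simplex_def
    by (intro closed_Collect_conj closed_Collect_all closed_Collect_le closed_Collect_eq continuous_intros)
  ultimately show ?thesis by (simp add: compact_eq_bounded_closed)
qed

lemma ex_pmf_of_weights:
  assumes "finite S" "\<And>x. x \<in> S \<Longrightarrow> 0 \<le> u x" "sum u S = 1"
  shows "\<exists>p. \<forall>x. pmf p x = (if x \<in> S then u x else 0)"
proof -
  let ?f = "\<lambda>x. if x \<in> S then u x else 0"
  have "(\<integral>\<^sup>+x. ennreal (?f x) \<partial>count_space UNIV) = (\<Sum>x\<in>S. ennreal (?f x))"
    using assms(1) by (intro nn_integral_count_space') auto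
  also have "\<dots> = 1" using assms by (simp add: sum_ennreal)
  finally have "pmf (embed_pmf ?f) x = ?f x" for x
    using assms(2) by (intro pmf_embed_pmf) auto
  then show ?thesis by blast
qed

definition pmf_vec :: "'n::finite pmf \<Rightarrow> real ^ 'n" where
  "pmf_vec q = (\<chi> x. pmf q x)"

lemma range_pmf_vec: "range pmf_vec = prob_simplex"
proof (intro equalityI subsetI)
  fix v :: "real ^ 'n" assume v: "v \<in> prob_simplex"
  then have "\<exists>q. \<forall>x. pmf q x = (if x \<in> UNIV then v $ x else 0)"
    by (intro ex_pmf_of_weights) (simp_all add: prob_simplex_def)
  then obtain q where "\<And>x. pmf q x = v $ x" by auto
  then have "v = pmf_vec q" by (simp add: pmf_vec_def vec_eq_iff)
  then show "v \<in> range pmf_vec" by simp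
next
  fix v :: "real ^ 'n" assume "v \<in> range pmf_vec"
  then show "v \<in> prob_simplex" by (auto simp: pmf_vec_def prob_simplex_def sum_pmf_eq_1)
qed

text \<open>Continuity in the vector of probabilities, expressed by a factorisation through
  \<open>pmf_vec\<close>. Compactness of the simplex then passes to ranges without a topology on
  pmfs.\<close>

definition pmf_continuous :: "('n::finite pmf \<Rightarrow> 'b::topological_space) \<Rightarrow> bool" where
  "pmf_continuous f \<longleftrightarrow> (\<exists>g. continuous_on prob_simplex g \<and> (\<forall>q. f q = g (pmf_vec q)))"

lemma compact_range_pmf_continuous:
  assumes "pmf_continuous f"
  shows "compact (range f)"
proof -
  obtain g where g: "continuous_on prob_simplex g" "\<And>q. f q = g (pmf_vec q)"
    using assms by (auto simp: pmf_continuous_def)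
  have "range f = g ` prob_simplex" unfolding range_pmf_vec[symmetric] by (auto simp: g(2))
  then show ?thesis using compact_continuous_image[OF g(1) compact_prob_simplex] by simp
qed

lemma pmf_continuous_Pair:
  assumes "pmf_continuous f" "pmf_continuous f'"
  shows "pmf_continuous (\<lambda>q. (f q, f' q))"
proof -
  obtain g g' where "continuous_on prob_simplex g" "\<And>q. f q = g (pmf_vec q)"
    "continuous_on prob_simplex g'" "\<And>q. f' q = g' (pmf_vec q)"
    using assms by (auto simp: pmf_continuous_def)
  then show ?thesis
    unfolding pmf_continuous_def by (intro exI[of _ "\<lambda>v. (g v, g' v)"]) (simp add: continuous_on_Pair)
qed

lemma pmf_continuous_compose:
  assumes "pmf_continuous f" "continuous_on UNIV h"
  shows "pmf_continuous (\<lambda>q. h (f q))"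
proof -
  obtain g where "continuous_on prob_simplex g" "\<And>q. f q = g (pmf_vec q)"
    using assms(1) by (auto simp: pmf_continuous_def)
  then show ?thesis
    unfolding pmf_continuous_def
    by (intro exI[of _ "\<lambda>v. h (g v)"]) (simp add: continuous_on_compose2[OF assms(2)])
qed

lemma pmf_continuous_add:
  fixes f f' :: "'n::finite pmf \<Rightarrow> real"
  assumes "pmf_continuous f" "pmf_continuous f'"
  shows "pmf_continuous (\<lambda>q. f q + f' q)"
  using pmf_continuous_compose[OF pmf_continuous_Pair[OF assms], of "\<lambda>x. fst x + snd x"]
  by (simp add: continuous_on_add continuous_on_fst continuous_on_snd)

lemma pmf_continuous_diff:
  fixes f f' :: "'n::finite pmf \<Rightarrow> real"
  assumes "pmf_continuous f" "pmf_continuous f'"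
  shows "pmf_continuous (\<lambda>q. f q - f' q)"
  using pmf_continuous_compose[OF pmf_continuous_Pair[OF assms], of "\<lambda>x. fst x - snd x"]
  by (simp add: continuous_on_diff continuous_on_fst continuous_on_snd)

text \<open>Each probability of a value of \<open>X\<close> is a linear form in \<open>q\<close>,
  nonnegative on the simplex. The entropy is thus a finite sum of continuous terms - m log
  m.\<close>

lemma pmf_continuous_H:
  fixes X :: "'n::finite \<times> 'z \<Rightarrow> 's::finite"
  shows "pmf_continuous (\<lambda>q. H (joint_pmf q V) X)"
proof -
  let ?L = "\<lambda>x. map_pmf (\<lambda>z. X (x, z)) (V x)"
  let ?m = "\<lambda>s v. \<Sum>x\<in>UNIV. v $ x * pmf (?L x) s"
  define g where "g v = (\<Sum>s\<in>UNIV. - (?m s v * log 2 (?m s v)))" for v :: "real ^ 'n"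
  have "continuous_on prob_simplex (\<lambda>v. ?m s v * log 2 (?m s v))" for s
    by (rule continuous_on_compose2[OF continuous_on_entropy_term, of _ "?m s"])
      (auto simp: prob_simplex_def intro!: continuous_intros sum_nonneg)
  then have "continuous_on prob_simplex g"
    unfolding g_def by (intro continuous_on_sum continuous_on_minus)
  moreover have "H (joint_pmf q V) X = g (pmf_vec q)" for q
  proof -
    have m: "pmf (map_pmf X (joint_pmf q V)) s = ?m s (pmf_vec q)" for s
      by (simp add: joint_pmf_def map_bind_pmf map_pmf_comp pmf_bind pmf_vec_def
          integral_measure_pmf[of UNIV])
    show ?thesis
      unfolding ent_def g_def m[symmetric] by (subst integral_measure_pmf[of UNIV]) simp_all
  qed
  ultimately show ?thesis unfolding pmf_continuous_def by blast
qed

lemma compact_range_single_letter: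
  fixes V :: "'x1::finite \<times> 'x2::finite \<Rightarrow> ('y::finite \<times> 'f::finite) pmf"
  shows "compact (range (single_letter V))"
  unfolding single_letter_def[abs_def] Let_def cmi_def
  by (intro compact_range_pmf_continuous pmf_continuous_Pair pmf_continuous_diff pmf_continuous_add pmf_continuous_H)

text \<open>Caratheodory in dimension 4 gives at most five points, and 5 \<le>
  \<open>CARD('a) + 3\<close> once \<open>CARD('a) \<ge> 2\<close>. If \<open>CARD('a) = 1\<close>
  there is only one law, so the hull is generated by a single point.\<close>

lemma convex_hull_range_finite_time_sharing:
  fixes f :: "'a::finite pmf \<Rightarrow> real \<times> real \<times> real \<times> real"
  assumes v: "v \<in> convex hull (range f)"
  obtains \<mu> :: "nat pmf" and \<kappa> where "finite (set_pmf \<mu>)" "card (set_pmf \<mu>) \<le> CARD('a) + 3"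
    "v = (\<Sum>t\<in>set_pmf \<mu>. pmf \<mu> t *\<^sub>R f (\<kappa> t))"
proof -
  obtain S u where S: "finite S" "S \<subseteq> range f" "card S \<le> DIM(real \<times> real \<times> real \<times> real) + 1"
    and u: "\<forall>x\<in>S. 0 \<le> u x" "sum u S = 1" "(\<Sum>x\<in>S. u x *\<^sub>R x) = v"
    using v unfolding convex_hull_caratheodory mem_Collect_eq by (elim exE conjE)
  have cS: "card S \<le> CARD('a) + 3"
  proof (cases "CARD('a) = 1")
    case True
    then obtain a where a: "(UNIV :: 'a set) = {a}" by (rule card_1_singletonE)
    have "f q = f (return_pmf a)" for q
    proof -
      have "set_pmf q \<subseteq> {a}" unfolding a[symmetric] by (rule subset_UNIV)
      then show ?thesis by (simp only: set_pmf_subset_singleton)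
    qed
    then have "range f \<subseteq> {f (return_pmf a)}" by blast
    then have "card S \<le> card {f (return_pmf a)}" using S(2) by (intro card_mono subset_trans[OF S(2)]) simp_all
    then show ?thesis by simp
  next
    case False
    then have "CARD('a) \<ge> 2" using zero_less_card_finite[where 'a='a] by linarith
    then show ?thesis using S(3) by simp
  qed
  have "\<exists>p. \<forall>x. pmf p x = (if x \<in> S then u x else 0)"
    by (rule ex_pmf_of_weights[OF S(1) bspec[OF u(1)] u(2)])
  then obtain p where p: "\<forall>x. pmf p x = (if x \<in> S then u x else 0)" ..
  have pS: "set_pmf p \<subseteq> S" by (simp add: subset_iff set_pmf_iff p)
  have fp: "finite (set_pmf p)" using pS S(1) by (rule finite_subset)
  \<comment> \<open>The points of positive weight are numbered to serve as values of T;
    \<open>g\<close> decodes a number into an input law that \<open>f\<close> maps to the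
    point.\<close>
  obtain h :: "_ \<Rightarrow> nat" where h: "inj_on h (set_pmf p)"
    using finite_imp_inj_to_nat_seg[OF fp] by (elim exE conjE)
  define g where "g t = inv_into UNIV f (inv_into (set_pmf p) h t)" for t
  have g: "f (g (h x)) = x" if "x \<in> set_pmf p" for x
  proof -
    have "x \<in> range f" using that pS S(2) by blast
    then show ?thesis unfolding g_def inv_into_f_f[OF h that] by (rule f_inv_into_f)
  qed
  have "(\<Sum>t\<in>set_pmf (map_pmf h p). pmf (map_pmf h p) t *\<^sub>R f (g t)) =
      (\<Sum>x\<in>set_pmf p. pmf (map_pmf h p) (h x) *\<^sub>R f (g (h x)))"
    by (simp only: set_map_pmf sum.reindex[OF h] o_def)
  also have "\<dots> = (\<Sum>x\<in>set_pmf p. pmf p x *\<^sub>R x)"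
    by (intro sum.cong refl) (simp only: pmf_map_inj[OF h] g)
  also have "\<dots> = (\<Sum>x\<in>S. pmf p x *\<^sub>R x)"
    using S(1) pS by (rule sum.mono_neutral_left) (simp add: set_pmf_iff del: split_paired_All)
  also have "\<dots> = v"
    unfolding u(3)[symmetric] by (intro sum.cong refl) (simp only: p if_True)
  finally have v: "v = (\<Sum>t\<in>set_pmf (map_pmf h p). pmf (map_pmf h p) t *\<^sub>R f (g t))" ..
  have "card (set_pmf (map_pmf h p)) \<le> card (set_pmf p)"
    unfolding set_map_pmf by (rule card_image_le[OF fp])
  also have "\<dots> \<le> card S" by (rule card_mono[OF S(1) pS])
  also note cS
  finally show ?thesis
    using fp by (intro that[OF _ _ v]) (simp_all only: set_map_pmf finite_imageI)
qed

section \<open>The converse for a single code\<close>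

definition run ::
  "('x1, 'x2, 'y, 'f1, 'f2) mac_gf \<Rightarrow> ('f1, 'x1) encoder \<Rightarrow> ('f2, 'x2) encoder \<Rightarrow>
    (nat \<times> nat) pmf \<Rightarrow> nat \<Rightarrow> ((nat \<times> nat) \<times> ('y \<times> 'f1 \<times> 'f2) list) pmf" where
  "run W e1 e2 m i = joint_pmf m (\<lambda>w. transmission W e1 e2 (fst w) (snd w) i)"

definition input1 :: "('f1, 'x1) encoder \<Rightarrow> (nat \<times> nat) \<times> ('y \<times> 'f1 \<times> 'f2) list \<Rightarrow> 'x1" where
  "input1 e1 \<omega> = e1 (fst (fst \<omega>)) (map (\<lambda>z. fst (snd z)) (snd \<omega>))"

definition input2 :: "('f2, 'x2) encoder \<Rightarrow> (nat \<times> nat) \<times> ('y \<times> 'f1 \<times> 'f2) list \<Rightarrow> 'x2" where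
  "input2 e2 \<omega> = e2 (snd (fst \<omega>)) (map (\<lambda>z. snd (snd z)) (snd \<omega>))"

text \<open>The past and the new output triple stay separate components, as the one-step
  inequalities require; \<open>run_Suc\<close> then appends the triple to the history.\<close>

definition run_step ::
  "('x1, 'x2, 'y, 'f1, 'f2) mac_gf \<Rightarrow> ('f1, 'x1) encoder \<Rightarrow> ('f2, 'x2) encoder \<Rightarrow>
    (nat \<times> nat) pmf \<Rightarrow> nat \<Rightarrow> (((nat \<times> nat) \<times> ('y \<times> 'f1 \<times> 'f2) list) \<times> 'y \<times> 'f1 \<times> 'f2) pmf" where
  "run_step W e1 e2 m i =
    joint_pmf (run W e1 e2 m i) (\<lambda>\<omega>. case_prod W (input1 e1 \<omega>, input2 e2 \<omega>))"

lemma run_Suc: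
  "run W e1 e2 m (Suc i) = map_pmf (\<lambda>s. (fst (fst s), snd (fst s) @ [snd s])) (run_step W e1 e2 m i)"
  by (simp add: run_def run_step_def joint_pmf_def input1_def input2_def map_bind_pmf bind_map_pmf
      map_pmf_comp bind_assoc_pmf case_prod_beta')

lemma finite_set_run:
  fixes W :: "('x1, 'x2, 'y::finite, 'f1::finite, 'f2::finite) mac_gf"
  assumes "finite (set_pmf m)"
  shows "finite (set_pmf (run W e1 e2 m i))"
proof (induction i)
  case 0
  then show ?case using assms by (simp add: run_def)
next
  case (Suc i)
  then show ?case by (simp add: run_Suc run_step_def)
qed

lemma messages_and_output_run:
  "messages_and_output W n M1 M2 e1 e2 =
    map_pmf (\<lambda>\<omega>. (fst \<omega>, map fst (snd \<omega>)))
      (run W e1 e2 (pair_pmf (pmf_of_set {1..M1}) (pmf_of_set {1..M2})) n)"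
  by (simp add: messages_and_output_def run_def joint_pmf_def map_bind_pmf map_pmf_comp case_prod_beta')

lemma H_run_step: "H (run_step W e1 e2 m i) (\<lambda>s. B (fst s)) = H (run W e1 e2 m i) B"
proof -
  have "map_pmf (\<lambda>s. B (fst s)) (run_step W e1 e2 m i) = map_pmf B (map_pmf fst (run_step W e1 e2 m i))"
    by (simp only: map_pmf_comp)
  then show ?thesis by (simp add: run_step_def map_fst_joint_pmf)
qed

lemma H_run_0: "H (run W e1 e2 m 0) (\<lambda>\<omega>. (b (fst \<omega>), snd \<omega>)) = H m b"
proof -
  have "map_pmf (\<lambda>\<omega>. (b (fst \<omega>), snd \<omega>)) (run W e1 e2 m 0) = map_pmf (\<lambda>x. (x, [])) (map_pmf b m)"
    by (simp add: run_def joint_pmf_def map_bind_pmf map_pmf_comp map_pmf_def bind_assoc_pmf bind_return_pmf)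
  then show ?thesis by (simp only:) (rule ent_map_inj, simp add: inj_on_def)
qed

text \<open>
  For \<open>b = snd\<close>, \<open>fst\<close> or constant, the left-hand side is \<open>I(W\<^sub>1; Z\<^sup>n | W\<^sub>2)\<close>, \<open>I(W\<^sub>2; Z\<^sup>n | W\<^sub>1)\<close> or
  \<open>I(W\<^sub>1, W\<^sub>2; Z\<^sup>n)\<close>.
\<close>

lemma run_information:
  fixes W :: "('x1, 'x2, 'y::finite, 'f1::finite, 'f2::finite) mac_gf" and b :: "nat \<times> nat \<Rightarrow> 'b"
  assumes m: "finite (set_pmf m)"
    and W: "\<And>x1 x2. W x1 x2 = joint_pmf (P x1 x2) Q"
    and X: "\<And>\<omega>. (input1 e1 \<omega>, input2 e2 \<omega>) = \<phi> (A \<omega>, C \<omega>)"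
    and C: "\<And>\<omega>. C \<omega> = g (b (fst \<omega>), snd \<omega>)"
  shows "H (run W e1 e2 m n) (\<lambda>\<omega>. (b (fst \<omega>), snd \<omega>)) - ent (run W e1 e2 m n) - (H m b - ent m)
    \<le> (\<Sum>i<n. cmi (run_step W e1 e2 m i) (\<lambda>s. A (fst s)) (\<lambda>s. fst (snd s)) (\<lambda>s. C (fst s)))"
proof (induction n)
  case 0
  have "ent (run W e1 e2 m 0) = ent m"
    using H_run_0[of "\<lambda>x. x" W e1 e2 m] by simp
  then show ?case by (simp add: H_run_0)
next
  case (Suc i)
  let ?r = "run W e1 e2 m i" and ?J = "run_step W e1 e2 m i"
  have J: "?J = joint_pmf ?r (\<lambda>\<omega>. joint_pmf (case_prod P (input1 e1 \<omega>, input2 e2 \<omega>)) Q)"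
    by (simp add: run_step_def W)
  have "(H ?J (\<lambda>s. ((b (fst (fst s)), snd (fst s)), snd s)) - H ?J (\<lambda>s. (b (fst (fst s)), snd (fst s)))) - (ent ?J - H ?J fst)
     \<le> cmi ?J (\<lambda>s. A (fst s)) (\<lambda>s. fst (snd s)) (\<lambda>s. C (fst s))"
    unfolding J
    by (rule information_step[where X="\<lambda>\<omega>. (input1 e1 \<omega>, input2 e2 \<omega>)" and \<phi>=\<phi> and A=A and C=C
          and B="\<lambda>\<omega>. (b (fst \<omega>), snd \<omega>)" and g=g])
      (rule finite_set_run[OF m] finite X C)+
  \<comment> \<open>Appending the new symbol to the history is injective, so the sum
    telescopes.\<close>
  moreover have "H ?J (\<lambda>s. ((b (fst (fst s)), snd (fst s)), snd s)) = H (run W e1 e2 m (Suc i)) (\<lambda>\<omega>. (b (fst \<omega>), snd \<omega>))"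
    unfolding run_Suc map_pmf_comp
    by (rule H_inj[of "\<lambda>((b, h), z). (b, h @ [z])", symmetric]) (auto intro!: inj_onI)
  moreover have "ent ?J = ent (run W e1 e2 m (Suc i))"
    unfolding run_Suc by (rule ent_map_inj[symmetric]) (auto intro!: inj_onI)
  moreover have "H ?J (\<lambda>s. (b (fst (fst s)), snd (fst s))) = H ?r (\<lambda>\<omega>. (b (fst \<omega>), snd \<omega>))"
    by (rule H_run_step)
  moreover have "H ?J fst = ent ?r"
    using H_run_step[of "\<lambda>x. x" W e1 e2 m i] by simp
  ultimately show ?case using Suc.IH by simp
qed

text \<open>I(W1; W2 | F^i) acts as a potential: \<open>dependence_step\<close> bounds each
  increment, and at time 0 the feedback history is empty, which leaves I(W1; W2).\<close>

lemma run_dependence: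
  fixes W :: "('x1, 'x2, 'y::finite, 'f1::finite, 'f2::finite) mac_gf"
  assumes m: "finite (set_pmf m)"
  shows "cmi (run W e1 e2 m n) (\<lambda>\<omega>. fst (fst \<omega>)) (\<lambda>\<omega>. snd (fst \<omega>)) (\<lambda>\<omega>. map snd (snd \<omega>)) - cmi m fst snd (\<lambda>_. ())
    \<le> (\<Sum>i<n. cmi (run_step W e1 e2 m i) (\<lambda>s. input1 e1 (fst s)) (\<lambda>s. input2 e2 (fst s))
          (\<lambda>s. (snd (snd s), map snd (snd (fst s))))
        - cmi (run_step W e1 e2 m i) (\<lambda>s. input1 e1 (fst s)) (\<lambda>s. input2 e2 (fst s))
          (\<lambda>s. map snd (snd (fst s))))"
proof (induction n)
  case 0
  let ?r = "run W e1 e2 m 0"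
  have "map_pmf fst ?r = m" by (simp only: run_def map_fst_joint_pmf)
  then have "cmi m fst snd (\<lambda>_. ()) = cmi ?r (\<lambda>\<omega>. fst (fst \<omega>)) (\<lambda>\<omega>. snd (fst \<omega>)) (\<lambda>_. ())"
    using cmi_map[of fst ?r fst snd "\<lambda>_. ()"] by (simp only:)
  also have "\<dots> = cmi ?r (\<lambda>\<omega>. fst (fst \<omega>)) (\<lambda>\<omega>. snd (fst \<omega>)) (\<lambda>_. [] :: ('f1 \<times> 'f2) list)"
    by (rule cmi_inj[where f="\<lambda>_. []" and C="\<lambda>_. ()", symmetric]) (simp add: inj_def)
  also have "\<dots> = cmi ?r (\<lambda>\<omega>. fst (fst \<omega>)) (\<lambda>\<omega>. snd (fst \<omega>)) (\<lambda>\<omega>. map snd (snd \<omega>))"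
    by (rule cmi_cong) (auto simp: run_def set_joint_pmf)
  finally show ?case by simp
next
  case (Suc i)
  let ?J = "run_step W e1 e2 m i" and ?T = "\<lambda>\<omega>. map snd (snd \<omega>)"
  let ?W1 = "\<lambda>s. fst (fst (fst s))" and ?W2 = "\<lambda>s. snd (fst (fst s))"
  have "cmi ?J ?W1 ?W2 (\<lambda>s. (snd (snd s), ?T (fst s))) - cmi ?J ?W1 ?W2 (\<lambda>s. ?T (fst s))
    \<le> cmi ?J (\<lambda>s. input1 e1 (fst s)) (\<lambda>s. input2 e2 (fst s)) (\<lambda>s. (snd (snd s), ?T (fst s)))
    - cmi ?J (\<lambda>s. input1 e1 (fst s)) (\<lambda>s. input2 e2 (fst s)) (\<lambda>s. ?T (fst s))"
    unfolding run_step_def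
    \<comment> \<open>T consists of feedback pairs, and each encoder reads only its own component,
      so each input is a function of its own message and T.\<close>
    by (rule dependence_step[where \<phi>="\<lambda>(w, t). e1 w (map fst t)" and \<psi>="\<lambda>(w, t). e2 w (map snd t)"
          and W="\<lambda>\<omega>. fst (fst \<omega>)" and W'="\<lambda>\<omega>. snd (fst \<omega>)"])
      (auto simp: input1_def input2_def comp_def finite_set_run[OF m])
  moreover have "cmi (run W e1 e2 m (Suc i)) (\<lambda>\<omega>. fst (fst \<omega>)) (\<lambda>\<omega>. snd (fst \<omega>)) ?T =
      cmi ?J ?W1 ?W2 (\<lambda>s. (snd (snd s), ?T (fst s)))"
    using cmi_inj[of "\<lambda>(z, t). t @ [z]" ?J ?W1 ?W2 "\<lambda>s. (snd (snd s), ?T (fst s))"]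
    by (simp add: run_Suc cmi_map inj_def)
  moreover have "cmi ?J ?W1 ?W2 (\<lambda>s. ?T (fst s)) =
      cmi (run W e1 e2 m i) (\<lambda>\<omega>. fst (fst \<omega>)) (\<lambda>\<omega>. snd (fst \<omega>)) ?T"
    using cmi_map[of fst ?J "\<lambda>\<omega>. fst (fst \<omega>)" "\<lambda>\<omega>. snd (fst \<omega>)" ?T]
    by (simp add: run_step_def map_fst_joint_pmf)
  ultimately show ?case using Suc.IH by simp
qed

text \<open>The left side is H(c | b, Z^n), since \<open>c\<close> and \<open>b\<close> together
  determine the message pair. The guess for \<open>c\<close> is read off the decoder's output, and
  it is wrong only if the decoder errs.\<close>

lemma run_fano:
  fixes W :: "('x1, 'x2, 'y::finite, 'f1::finite, 'f2::finite) mac_gf"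
  defines "m M1 M2 \<equiv> pair_pmf (pmf_of_set {1..M1}) (pmf_of_set {1..M2})"
  assumes code: "is_code W n M1 M2 Pe e1 e2 g"
    and A: "finite A" "\<And>w. w \<in> {1..M1} \<times> {1..M2} \<Longrightarrow> c w \<in> A"
    and bc: "inj (\<lambda>w. (c w, b w))"
  shows "ent (run W e1 e2 (m M1 M2) n) - H (run W e1 e2 (m M1 M2) n) (\<lambda>\<omega>. (b (fst \<omega>), snd \<omega>))
    \<le> 1 + Pe * log 2 (card A)"
proof -
  let ?r = "run W e1 e2 (m M1 M2) n"
  have M: "M1 \<ge> 1" "M2 \<ge> 1" using code by (auto simp: is_code_def)
  have sm: "set_pmf (m M1 M2) = {1..M1} \<times> {1..M2}" using M by (simp add: m_def)
  have fr: "finite (set_pmf ?r)" by (rule finite_set_run) (simp add: sm)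
  have cA: "c (fst \<omega>) \<in> A" if "\<omega> \<in> set_pmf ?r" for \<omega>
    using that A(2) by (auto simp: run_def set_joint_pmf sm)
  have "set_pmf ?r \<noteq> {}" by (rule set_pmf_not_empty)
  then have A0: "A \<noteq> {}" using cA by blast
  have card: "real (card A) \<ge> 1" using A(1) A0 by (simp add: Suc_leI card_gt_0_iff)
  let ?V = "\<lambda>\<omega>. (b (fst \<omega>), snd \<omega>)"
  have "ent ?r = H ?r (\<lambda>\<omega>. (c (fst \<omega>), ?V \<omega>))"
  proof (intro ent_map_inj[symmetric] inj_onI)
    fix x y assume eq: "(c (fst x), ?V x) = (c (fst y), ?V y)"
    then have "fst x = fst y" by (intro injD[OF bc]) simp
    with eq show "x = y" by (simp add: prod_eq_iff)
  qed
  moreover have "H ?r (\<lambda>\<omega>. (c (fst \<omega>), ?V \<omega>)) - H ?r ?V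
      \<le> 1 + measure_pmf.prob ?r {\<omega>. c (g (map fst (snd (?V \<omega>)))) \<noteq> c (fst \<omega>)} * log 2 (card A)"
    by (rule fano_inequality[OF fr A(1) A0 cA])
  moreover have "measure_pmf.prob ?r {\<omega>. c (g (map fst (snd (?V \<omega>)))) \<noteq> c (fst \<omega>)} \<le> Pe"
  proof -
    have "Pe = measure_pmf.prob ?r {\<omega>. g (map fst (snd \<omega>)) \<noteq> fst \<omega>}"
      using code by (simp add: is_code_def error_prob_def messages_and_output_run m_def vimage_def)
    moreover have "measure_pmf.prob ?r {\<omega>. c (g (map fst (snd (?V \<omega>)))) \<noteq> c (fst \<omega>)}
       \<le> measure_pmf.prob ?r {\<omega>. g (map fst (snd \<omega>)) \<noteq> fst \<omega>}"
      by (intro measure_pmf.finite_measure_mono) auto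
    ultimately show ?thesis by simp
  qed
  ultimately show ?thesis
    using card by (smt (verit) mult_right_mono zero_le_log_cancel_iff)
qed

text \<open>Fano's inequality bounds the message informations from below and
  \<open>run_information\<close> bounds them from above by sums over time. Division by
  \<open>n\<close> turns the sums into averages.\<close>

lemma single_letter_converse:
  fixes W :: "('x1, 'x2, 'y::finite, 'f1::finite, 'f2::finite) mac_gf"
  assumes W: "\<And>x1 x2. W x1 x2 = joint_pmf (P x1 x2) Q"
    and code: "is_code W n M1 M2 Pe e1 e2 g" and n: "n \<ge> 1"
  shows "\<exists>(a, b, c, d) \<in> convex hull (range (single_letter (case_prod W))).
    (1 - Pe) * log 2 M1 - 1 \<le> n * a \<and> (1 - Pe) * log 2 M2 - 1 \<le> n * b \<and>
    (1 - Pe) * (log 2 M1 + log 2 M2) - 1 \<le> n * c \<and> 0 \<le> d"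
proof -
  define m where "m = pair_pmf (pmf_of_set {1..M1}) (pmf_of_set {1..M2})"
  let ?r = "run W e1 e2 m n" and ?J = "run_step W e1 e2 m" and ?T = "\<lambda>s. map snd (snd (fst s))"
  let ?X1 = "\<lambda>s. input1 e1 (fst s)" and ?X2 = "\<lambda>s. input2 e2 (fst s)" and ?Y = "\<lambda>s. fst (snd s)"
  define v where "v i = (cmi (?J i) ?X1 ?Y (\<lambda>s. (?X2 s, ?T s)), cmi (?J i) ?X2 ?Y (\<lambda>s. (?X1 s, ?T s)),
     cmi (?J i) (\<lambda>s. (?X1 s, ?X2 s)) ?Y ?T,
     cmi (?J i) ?X1 ?X2 (\<lambda>s. (snd (snd s), ?T s)) - cmi (?J i) ?X1 ?X2 ?T)" for i
  have M: "M1 \<ge> 1" "M2 \<ge> 1" using code by (auto simp: is_code_def)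
  have fm: "finite (set_pmf m)" using M by (simp add: m_def)
  have "v i \<in> convex hull (range (single_letter (case_prod W)))" for i
    unfolding v_def run_step_def
    by (rule single_letter_average[where T="\<lambda>\<omega>. map snd (snd \<omega>)", OF finite_set_run[OF fm] finite])
  \<comment> \<open>Uniform weights over the \<open>n\<close> channel uses.\<close>
  then have hull: "(\<Sum>i<n. (1 / n) *\<^sub>R v i) \<in> convex hull (range (single_letter (case_prod W)))"
    using n by (intro convex_sum) auto
  have h1: "H m fst = log 2 M1" and h2: "H m snd = log 2 M2" and h12: "ent m = log 2 M1 + log 2 M2"
    using M by (simp_all add: m_def map_fst_pair_pmf map_snd_pair_pmf ent_pmf_of_set ent_pair_pmf)
  have "ent ?r - H ?r (\<lambda>\<omega>. (snd (fst \<omega>), snd \<omega>)) \<le> 1 + Pe * log 2 (card {1..M1})"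
    unfolding m_def by (rule run_fano[OF code, where c=fst]) (auto intro: injI)
  moreover have "H ?r (\<lambda>\<omega>. (snd (fst \<omega>), snd \<omega>)) - ent ?r - (H m snd - ent m) \<le> (\<Sum>i<n. fst (v i))"
    unfolding v_def fst_conv
    \<comment> \<open>\<open>W2\<close> is known here. Hence the conditioning variable may contain
      the second input along with the feedback T: \<open>g\<close> computes both from
      \<open>W2\<close> and the history.\<close>
    by (rule run_information[where A="input1 e1" and C="\<lambda>\<omega>. (input2 e2 \<omega>, map snd (snd \<omega>))"
          and g="\<lambda>(w, h). (e2 w (map (\<lambda>z. snd (snd z)) h), map snd h)" and \<phi>="\<lambda>(x, y, t). (x, y)", OF fm W])
      (auto simp: input2_def)
  ultimately have a: "(1 - Pe) * log 2 M1 - 1 \<le> (\<Sum>i<n. fst (v i))"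
    by (simp add: h2 h12 algebra_simps)
  have "ent ?r - H ?r (\<lambda>\<omega>. (fst (fst \<omega>), snd \<omega>)) \<le> 1 + Pe * log 2 (card {1..M2})"
    unfolding m_def by (rule run_fano[OF code, where c=snd]) (auto intro: injI)
  moreover have "H ?r (\<lambda>\<omega>. (fst (fst \<omega>), snd \<omega>)) - ent ?r - (H m fst - ent m) \<le> (\<Sum>i<n. fst (snd (v i)))"
    unfolding v_def fst_conv snd_conv
    by (rule run_information[where A="input2 e2" and C="\<lambda>\<omega>. (input1 e1 \<omega>, map snd (snd \<omega>))"
          and g="\<lambda>(w, h). (e1 w (map (\<lambda>z. fst (snd z)) h), map snd h)" and \<phi>="\<lambda>(y, x, t). (x, y)", OF fm W])
      (auto simp: input1_def)
  ultimately have b: "(1 - Pe) * log 2 M2 - 1 \<le> (\<Sum>i<n. fst (snd (v i)))"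
    by (simp add: h1 h12 algebra_simps)
  have "ent ?r - H ?r (\<lambda>\<omega>. ((), snd \<omega>)) \<le> 1 + Pe * log 2 (card ({1..M1} \<times> {1..M2}))"
    unfolding m_def by (rule run_fano[OF code, where c="\<lambda>w. w"]) (auto intro: injI)
  moreover have "H ?r (\<lambda>\<omega>. ((), snd \<omega>)) - ent ?r - (H m (\<lambda>_. ()) - ent m) \<le> (\<Sum>i<n. fst (snd (snd (v i))))"
    unfolding v_def fst_conv snd_conv
    by (rule run_information[where A="\<lambda>\<omega>. (input1 e1 \<omega>, input2 e2 \<omega>)" and C="\<lambda>\<omega>. map snd (snd \<omega>)"
          and g="\<lambda>(w, h). map snd h" and \<phi>=fst, OF fm W]) auto
  moreover have "log 2 (card ({1..M1} \<times> {1..M2})) = log 2 M1 + log 2 M2"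
    using M by (simp add: card_cartesian_product log_mult)
  ultimately have c: "(1 - Pe) * (log 2 M1 + log 2 M2) - 1 \<le> (\<Sum>i<n. fst (snd (snd (v i))))"
    by (simp add: h12 algebra_simps)
  \<comment> \<open>The messages are independent, so the potential starts at zero.\<close>
  have "cmi m fst snd (\<lambda>_. ()) = 0"
  proof -
    have "H m (\<lambda>\<omega>. (fst \<omega>, ())) = H m fst" "H m (\<lambda>\<omega>. (snd \<omega>, ())) = H m snd"
      by (rule H_inj[of "\<lambda>x. (x, ())"]; auto intro!: inj_onI)+
    moreover have "H m (\<lambda>\<omega>. (fst \<omega>, snd \<omega>, ())) = ent m"
      by (rule ent_map_inj) (auto intro!: inj_onI)
    ultimately show ?thesis by (simp add: cmi_def h1 h2 h12)
  qed
  \<comment> \<open>The potential starts at zero and ends nonnegative, so its increments, and with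
    them their upper bounds, have nonnegative sum.\<close>
  then have d: "0 \<le> (\<Sum>i<n. snd (snd (snd (v i))))"
    using run_dependence[OF fm, of W e1 e2 n] cmi_nonneg[OF finite_set_run[OF fm], of W e1 e2 n
        "\<lambda>\<omega>. fst (fst \<omega>)" "\<lambda>\<omega>. snd (fst \<omega>)" "\<lambda>\<omega>. map snd (snd \<omega>)"]
    by (simp add: v_def)
  have n0: "real n > 0" using n by simp
  show ?thesis
    by (rule bexI[OF _ hull]) (use a b c d n0 in \<open>simp add: case_prod_beta' fst_sum snd_sum
      sum_distrib_left[symmetric] sum_divide_distrib[symmetric]\<close>)
qed

section \<open>The dependence balance bound\<close>

text \<open>The weights of a convex combination become the law of T and its points become
  conditional input laws; the condition \<open>0 \<le> d\<close> is the dependence balance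
  bound.\<close>

lemma single_letter_hull_imp_DB_NF:
  fixes P :: "'x1::finite \<Rightarrow> 'x2::finite \<Rightarrow> 'y::finite pmf"
    and Q1 :: "'y \<Rightarrow> 'f1::finite pmf" and Q2 :: "'y \<Rightarrow> 'f2::finite pmf"
  defines "V \<equiv> \<lambda>x. joint_pmf (case_prod P x) (\<lambda>y. pair_pmf (Q1 y) (Q2 y))"
  assumes v: "(a, b, c, d) \<in> convex hull (range (single_letter V))"
    and R: "0 \<le> R1" "0 \<le> R2" "R1 \<le> a" "R2 \<le> b" "R1 + R2 \<le> c" "0 \<le> d"
  shows "(R1, R2) \<in> DB_NF P Q1 Q2"
proof -
  obtain \<mu> :: "nat pmf" and \<kappa> where f\<mu>: "finite (set_pmf \<mu>)"
    and card: "card (set_pmf \<mu>) \<le> CARD('x1 \<times> 'x2) + 3"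
    and sum: "(a, b, c, d) = (\<Sum>t\<in>set_pmf \<mu>. pmf \<mu> t *\<^sub>R single_letter V (\<kappa> t))"
    by (rule convex_hull_range_finite_time_sharing[OF v])
  define K where "K = joint_pmf \<mu> (\<lambda>t. joint_pmf (\<kappa> t) V)"
  \<comment> \<open>Flattens the nested tuple of T, inputs, output and feedback into the six
    coordinates used in \<open>DB_NF\<close>.\<close>
  define f where "f = (\<lambda>s :: nat \<times> ('x1 \<times> 'x2) \<times> 'y \<times> 'f1 \<times> 'f2.
    (fst s, fst (fst (snd s)), snd (fst (snd s)), fst (snd (snd s)), fst (snd (snd (snd s))), snd (snd (snd (snd s)))))"
  define p where "p = map_pmf f K"
  have fK: "finite (set_pmf K)" using f\<mu> by (simp add: K_def)
  then have fp: "finite (set_pmf p)" by (simp add: p_def)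
  have f: "inj f" by (auto simp: f_def intro!: injI prod_eqI)
  have pmf_p: "pmf p (t, x1, x2, y, f1, f2) =
     pmf (joint_pmf \<mu> \<kappa>) (t, x1, x2) * pmf (P x1 x2) y * pmf (Q1 y) f1 * pmf (Q2 y) f2" for t x1 x2 y f1 f2
    using pmf_map_inj'[OF f, of K "(t, (x1, x2), y, f1, f2)"]
    by (simp add: p_def f_def K_def V_def pmf_joint_pmf pmf_pair mult.assoc)
  have T: "fst ` set_pmf p = set_pmf \<mu>"
  proof -
    have "map_pmf fst p = map_pmf fst K" by (simp add: p_def f_def map_pmf_comp)
    also have "\<dots> = \<mu>" by (simp add: K_def map_fst_joint_pmf)
    finally show ?thesis by (metis set_map_pmf)
  qed
  let ?X1 = "\<lambda>s. fst (fst (snd s))" and ?X2 = "\<lambda>s. snd (fst (snd s))" and ?Y = "\<lambda>s. fst (snd (snd s))"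
    and ?F = "\<lambda>s. snd (snd (snd s))"
  have *: "(cmi K ?X1 ?Y (\<lambda>s. (?X2 s, fst s)), cmi K ?X2 ?Y (\<lambda>s. (?X1 s, fst s)), cmi K (\<lambda>s. fst (snd s)) ?Y fst,
      cmi K ?X1 ?X2 (\<lambda>s. (?F s, fst s)) - cmi K ?X1 ?X2 fst) = (a, b, c, d)"
    unfolding sum K_def by (rule single_letter_time_sharing[OF f\<mu> finite finite])
  have F: "cmi K ?X1 ?X2 (\<lambda>s. (fst (?F s), snd (?F s), fst s)) = cmi K ?X1 ?X2 (\<lambda>s. (?F s, fst s))"
    using cmi_inj[of "\<lambda>x. (fst (fst x), snd (fst x), snd x)" K ?X1 ?X2 "\<lambda>s. (?F s, fst s)"]
    by (simp add: inj_def prod_eq_iff)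
  show ?thesis
    unfolding DB_NF_def Let_def mem_Collect_eq prod.case
  proof (intro conjI exI[of _ "set_pmf \<mu>"] exI[of _ "joint_pmf \<mu> \<kappa>"] exI[of _ p] allI)
    show "card (set_pmf \<mu>) \<le> CARD('x1) * CARD('x2) + 3" using card by simp
  qed (use R * F in \<open>simp_all add: f\<mu> T pmf_p cond_mutual_info_eq_cmi[OF fp] cmi_map[of f K, folded p_def] f_def case_prod_beta'\<close>)
qed

text \<open>Dividing the converse by \<open>n\<close> loses at most
  \<open>\<epsilon> * (R1 + R2)\<close> for decoding errors and \<open>1 / n\<close> for the
  additive constant; each is kept below \<open>\<delta> / 2\<close>.\<close>

lemma achievable_approximation:
  fixes W :: "('x1, 'x2, 'y::finite, 'f1::finite, 'f2::finite) mac_gf"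
  assumes W: "\<And>x1 x2. W x1 x2 = joint_pmf (P x1 x2) Q"
    and R: "achievable W (R1, R2)" and \<delta>: "\<delta> > 0"
  shows "\<exists>(a, b, c, d) \<in> convex hull (range (single_letter (case_prod W))).
    R1 - \<delta> \<le> a \<and> R2 - \<delta> \<le> b \<and> R1 + R2 - \<delta> \<le> c \<and> 0 \<le> d"
proof -
  have R0: "R1 \<ge> 0" "R2 \<ge> 0" using R by (auto simp: achievable_def)
  \<comment> \<open>The summand 1 keeps the denominator positive when both rates vanish, and the
    minimum with 1 keeps \<open>1 - \<epsilon>\<close> nonnegative.\<close>
  define \<epsilon> where "\<epsilon> = min 1 (\<delta> / (2 * (R1 + R2 + 1)))"
  have \<epsilon>: "\<epsilon> > 0" "\<epsilon> \<le> 1" using R0 \<delta> by (auto simp: \<epsilon>_def)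
  have "\<epsilon> * (R1 + R2) \<le> \<delta> / (2 * (R1 + R2 + 1)) * (R1 + R2 + 1)"
    using R0 \<delta> by (intro mult_mono) (auto simp: \<epsilon>_def)
  also have "\<dots> = \<delta> / 2" using R0 by (simp add: field_simps)
  finally have \<epsilon>R: "\<epsilon> * (R1 + R2) \<le> \<delta> / 2" .
  have "\<forall>\<^sub>F n in sequentially. \<exists>M1 M2 Pe e1 e2 g. is_code W n M1 M2 Pe e1 e2 g \<and>
        R1 \<le> log 2 (real M1) / real n \<and> R2 \<le> log 2 (real M2) / real n \<and> Pe \<le> \<epsilon>"
    using R \<epsilon>(1) by (simp add: achievable_def)
  \<comment> \<open>Ensures \<open>1 / n \<le> \<delta> / 2\<close>; the successor makes
    \<open>n\<close> positive.\<close>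
  moreover have "\<forall>\<^sub>F n in sequentially. n \<ge> Suc (nat \<lceil>2 / \<delta>\<rceil>)" by (rule eventually_ge_at_top)
  ultimately have "\<forall>\<^sub>F n in sequentially. (\<exists>M1 M2 Pe e1 e2 g. is_code W n M1 M2 Pe e1 e2 g \<and>
        R1 \<le> log 2 (real M1) / real n \<and> R2 \<le> log 2 (real M2) / real n \<and> Pe \<le> \<epsilon>) \<and> n \<ge> Suc (nat \<lceil>2 / \<delta>\<rceil>)"
    by (rule eventually_conj)
  then obtain n M1 M2 Pe e1 e2 g where code: "is_code W n M1 M2 Pe e1 e2 g"
    and r: "R1 \<le> log 2 (real M1) / real n" "R2 \<le> log 2 (real M2) / real n" and Pe: "Pe \<le> \<epsilon>"
    and n: "n \<ge> Suc (nat \<lceil>2 / \<delta>\<rceil>)"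
    using eventually_happens'[OF sequentially_bot] by blast
  have n1: "n \<ge> 1" using n by simp
  then have n0: "real n > 0" by simp
  have "2 / \<delta> \<le> real n" using n by linarith
  then have n\<delta>: "1 \<le> n * (\<delta> / 2)" using \<delta> by (simp add: field_simps)
  obtain a b c d :: real where v: "(a, b, c, d) \<in> convex hull (range (single_letter (case_prod W)))"
    and *: "(1 - Pe) * log 2 M1 - 1 \<le> n * a" "(1 - Pe) * log 2 M2 - 1 \<le> n * b"
      "(1 - Pe) * (log 2 M1 + log 2 M2) - 1 \<le> n * c" "0 \<le> d"
    using single_letter_converse[OF W code n1] by auto
  \<comment> \<open>One estimate for all three constraints, with \<open>r\<close> being
    \<open>R1\<close>, \<open>R2\<close> or their sum and \<open>L\<close> the matching log-size of
    the messages.\<close>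
  have bound: "r - \<delta> \<le> x" if "r \<le> L / n" "0 \<le> r" "r \<le> R1 + R2" "(1 - Pe) * L - 1 \<le> n * x" for r L x :: real
  proof -
    have nr: "n * r \<le> L" using that(1) n0 by (simp add: field_simps)
    have "0 \<le> n * r" using that(2) n0 by simp
    then have L0: "0 \<le> L" using nr by simp
    have "\<epsilon> * r \<le> \<delta> / 2" using \<epsilon>(1) by (intro order_trans[OF mult_left_mono[OF that(3)] \<epsilon>R]) simp
    then have "n * (\<epsilon> * r) \<le> n * (\<delta> / 2)" using n0 by (intro mult_left_mono) auto
    moreover have "(1 - \<epsilon>) * (n * r) \<le> (1 - \<epsilon>) * L" using nr \<epsilon>(2) by (intro mult_left_mono) auto
    moreover have "(1 - \<epsilon>) * L \<le> (1 - Pe) * L" using Pe L0 by (intro mult_right_mono) auto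
    ultimately have "n * (r - \<delta>) \<le> n * x" using that(4) n\<delta> by (simp add: algebra_simps)
    then show ?thesis using n0 by simp
  qed
  have "R1 - \<delta> \<le> a" "R2 - \<delta> \<le> b" using bound[OF r(1)] bound[OF r(2)] R0 *(1,2) by auto
  moreover have "R1 + R2 - \<delta> \<le> c"
    using bound[of "R1 + R2" "log 2 M1 + log 2 M2" c] r R0 *(3) by (simp add: add_divide_distrib)
  ultimately show ?thesis using v *(4) by (intro bexI[OF _ v]) simp
qed

text \<open>Brings the factorised channel into kernel form, with the two feedback links merged into
  one kernel from \<open>y\<close> to pairs.\<close>

lemma eq_joint_pmf_pairI:
  assumes "\<And>y f1 f2. pmf p (y, f1, f2) = pmf p' y * pmf (Q1 y) f1 * pmf (Q2 y) f2"
  shows "p = joint_pmf p' (\<lambda>y. pair_pmf (Q1 y) (Q2 y))"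
  by (rule pmf_eqI) (auto simp: assms pmf_joint_pmf pmf_pair split_paired_all)

theorem theorem3:
  fixes W :: "('x1::finite, 'x2::finite, 'y::finite, 'f1::finite, 'f2::finite) mac_gf"
    and P :: "'x1 \<Rightarrow> 'x2 \<Rightarrow> 'y pmf"
    and Q1 :: "'y \<Rightarrow> 'f1 pmf"
    and Q2 :: "'y \<Rightarrow> 'f2 pmf"
  assumes "\<And>x1 x2 y yF1 yF2.
    pmf (W x1 x2) (y, yF1, yF2) = pmf (P x1 x2) y * pmf (Q1 y) yF1 * pmf (Q2 y) yF2"
  shows "capacity_region W \<subseteq> DB_NF P Q1 Q2"
proof
  fix R assume "R \<in> capacity_region W"
  then obtain R1 R2 where R: "(R1, R2) \<in> closure {R. achievable W R}" "R = (R1, R2)"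
    by (cases R) (simp add: capacity_region_def)
  let ?S = "convex hull (range (single_letter (case_prod W)))"
  have W: "W x1 x2 = joint_pmf (P x1 x2) (\<lambda>y. pair_pmf (Q1 y) (Q2 y))" for x1 x2
    using assms by (rule eq_joint_pmf_pairI)
  have near: "\<exists>R1' R2'. achievable W (R1', R2') \<and> \<bar>R1' - R1\<bar> < \<delta> \<and> \<bar>R2' - R2\<bar> < \<delta>" if \<delta>: "\<delta> > 0" for \<delta>
  proof -
    obtain R' where R': "achievable W R'" "dist R' (R1, R2) < \<delta>"
      using R(1) \<delta> unfolding closure_approachable by blast
    have "\<bar>fst R' - R1\<bar> < \<delta>" "\<bar>snd R' - R2\<bar> < \<delta>"
      using R'(2) dist_fst_le[of R' "(R1, R2)"] dist_snd_le[of R' "(R1, R2)"] by (auto simp: dist_real_def)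
    then show ?thesis using R'(1) by (intro exI[of _ "fst R'"] exI[of _ "snd R'"]) simp
  qed
  have R0: "0 \<le> R1" "0 \<le> R2"
  proof -
    have "0 \<le> R1 + \<delta> \<and> 0 \<le> R2 + \<delta>" if \<delta>: "\<delta> > 0" for \<delta>
    proof -
      obtain R1' R2' where R': "achievable W (R1', R2')" "\<bar>R1' - R1\<bar> < \<delta>" "\<bar>R2' - R2\<bar> < \<delta>"
        using near[OF \<delta>] by auto
      from R'(1) have "0 \<le> R1'" "0 \<le> R2'" by (simp_all add: achievable_def)
      with R'(2,3) show ?thesis by linarith
    qed
    then show "0 \<le> R1" "0 \<le> R2" by (auto intro: field_le_epsilon)
  qed
  \<comment> \<open>The smallest of the four margins: it is nonnegative exactly when a point of the
    hull satisfies all four constraints.\<close>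
  define slack where "slack = (\<lambda>(a, b, c, d). min (min (a - R1) (b - R2)) (min (c - (R1 + R2)) d))"
  \<comment> \<open>Thirds suffice: in the sum constraint each rate costs at most \<delta>/3 for the
    closure, and the code costs another \<delta>/3.\<close>
  have approx: "\<exists>v\<in>?S. - \<delta> \<le> slack v" if \<delta>: "\<delta> > 0" for \<delta>
  proof -
    obtain R1' R2' where R': "achievable W (R1', R2')" "\<bar>R1' - R1\<bar> < \<delta> / 3" "\<bar>R2' - R2\<bar> < \<delta> / 3"
      using near[of "\<delta> / 3"] \<delta> by auto
    obtain a b c d where v: "(a, b, c, d) \<in> ?S"
      "R1' - \<delta> / 3 \<le> a" "R2' - \<delta> / 3 \<le> b" "R1' + R2' - \<delta> / 3 \<le> c" "0 \<le> d"
      using achievable_approximation[OF W R'(1), of "\<delta> / 3"] \<delta> by auto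
    have "- \<delta> \<le> slack (a, b, c, d)"
      using v(2-5) R'(2,3) \<delta> unfolding slack_def prod.case by linarith
    then show ?thesis using v(1) by blast
  qed
  have "continuous_on ?S slack"
    unfolding slack_def case_prod_beta' by (intro continuous_intros)
  moreover have "compact ?S" by (intro compact_convex_hull compact_range_single_letter)
  moreover have "?S \<noteq> {}" by simp
  \<comment> \<open>On the compact hull the slack attains its maximum. As the maximum is at least
    -\<delta> for every positive \<delta>, one point satisfies the constraints exactly.\<close>
  ultimately obtain v where v: "v \<in> ?S" "\<And>w. w \<in> ?S \<Longrightarrow> slack w \<le> slack v"
    using continuous_attains_sup[of ?S slack] by blast
  have "0 \<le> slack v"
  proof (rule field_le_epsilon)
    fix \<delta> :: real assume "\<delta> > 0"
    then obtain w where "w \<in> ?S" "- \<delta> \<le> slack w" using approx by blast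
    with v(2)[of w] show "0 \<le> slack v + \<delta>" by linarith
  qed
  moreover obtain a b c d where abcd: "v = (a, b, c, d)" by (cases v)
  ultimately have "R1 \<le> a" "R2 \<le> b" "R1 + R2 \<le> c" "0 \<le> d" by (auto simp: slack_def)
  moreover have "case_prod W = (\<lambda>x. joint_pmf (case_prod P x) (\<lambda>y. pair_pmf (Q1 y) (Q2 y)))"
    by (auto simp: W fun_eq_iff)
  ultimately show "R \<in> DB_NF P Q1 Q2"
    unfolding R(2) using v(1) R0 by (intro single_letter_hull_imp_DB_NF[of a b c d]) (simp_all add: abcd)
qed

end
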